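(* Let $\theta>0$ and let $q(\boldsymbol\lambda,\boldsymbol\lambda')$, $\boldsymbol\lambda,\boldsymbol\lambda'\in\Lambda_n$, be the rates of the chain of Chinese restaurants dynamics described in the context, with $Q=(q(\boldsymbol\lambda,\boldsymbol\lambda'))$. There is a unique Markov semi-group $(P_t(\boldsymbol\lambda,\boldsymbol\lambda'))_{t\ge0}$ solving the backward Kolmogorov equations $$\frac{\partial P_t}{\partial t}(\boldsymbol\lambda,\boldsymbol\lambda')=\sum_{\boldsymbol\lambda''\in\Lambda_n}q(\boldsymbol\lambda,\boldsymbol\lambda'')P_t(\boldsymbol\lambda'',\boldsymbol\lambda'),\qquad P_0(\boldsymbol\lambda,\boldsymbol\lambda')=\delta_{\boldsymbol\lambda,\boldsymbol\lambda'}.$$ It defines a Markov process $(\boldsymbol\lambda(t))_{t\ge0}$ with state space $\Lambda_n$, which has $\mathbb P_{L,n}$ as a reversible (hence stationary) measure.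
   Context: Let $d\ge1$, $n\in\mathbb N$, $L>0$, $V:\mathbb R^d\to(-\infty,\infty]$, $\theta>0$. A spatial partition of $n$ is a family $\boldsymbol\lambda=(\lambda_x)_{x\in\mathbb Z^d}$ of integer partitions (possibly empty) whose parts sum in total to $n$; $\Lambda_n$ is the set of these. Let $r_{xj}(\boldsymbol\lambda)$ be the number of parts of $\lambda_x$ equal to $j$ and $\eta_x(\boldsymbol\lambda)=\sum_jj\,r_{xj}(\boldsymbol\lambda)$. With constant weights $\theta_j\equiv\theta$, $$\mathbb P_{L,n}(\boldsymbol\lambda)=\frac1{Z_{L,n}}\prod_{x\in\mathbb Z^d}\prod_{j\ge1}\frac1{r_{xj}(\boldsymbol\lambda)!}\Bigl(\frac{\theta}{j}e^{-jV(x/L)}\Bigr)^{r_{xj}(\boldsymbol\lambda)},$$ where the normalization $Z_{L,n}$ is assumed finite (and non-zero), with $e^{-\infty}=0$, $0^0=1$. Dynamics. Each site $x$ is a restaurant with $\eta_x$ customers seated at tables whose sizes are the parts of $\lambda_x$. Let $g(0)=0$ and $g(m)=\frac m{\theta+m-1}$ for $m\ge1$. Let $t(x,y)\ge0$, $x,y\in\mathbb Z^d$, satisfy $\sum_yt(x,y)=1$ for all $x$ and $e^{-V(x/L)}t(x,y)=e^{-V(y/L)}t(y,x)$ for all $x,y$. A customer exits restaurant $x$ at total rate $g(\eta_x)$, chosen uniformly among the $\eta_x$ customers (so that he leaves a table of size $j$ with probability $p_-(j;\lambda_x)=j\,r_{xj}/\eta_x$; that table then has size $j-1$ and disappears if $j=1$).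 He chooses a new restaurant $y$ with probability $t(x,y)$ ($y=x$ allowed). In restaurant $y$, in the configuration after his departure from $x$, he joins some table of size $k\ge1$ with probability $p_+(k;\lambda_y)=k\,r_{yk}/(\eta_y+\theta)$, or opens a new table with probability $p_+(0;\lambda_y)=\theta/(\eta_y+\theta)$. For $\boldsymbol\lambda\ne\boldsymbol\lambda'$, $q(\boldsymbol\lambda,\boldsymbol\lambda')$ is the total rate of the resulting transition $\boldsymbol\lambda\to\boldsymbol\lambda'$, i.e. $g(\eta_x(\boldsymbol\lambda))\,t(x,y)\,p_-(j;\lambda_x)\,p_+(k;\lambda_y)$ if $\boldsymbol\lambda'$ arises from moving a customer from a $j$-table at $x$ to a $k$-table at $y$ (with $\lambda_y$ replaced by $\lambda_x$ with one part $j$ reduced by one when $y=x$), and $0$ if $\boldsymbol\lambda'$ does not arise in this way. Finally $q(\boldsymbol\lambda,\boldsymbol\lambda)=-\sum_{\boldsymbol\lambda'\ne\boldsymbol\lambda}q(\boldsymbol\lambda,\boldsymbol\lambda')$. *)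

theory Defs
  imports "HOL-Probability.Probability" "HOL-Library.Multiset"
begin

text \<open>
  The lattice of dimension \<open>d\<close> is \<^typ>\<open>int ^ 'd\<close>. An integer partition is the multiset of its
  (positive) parts, so that the number of parts equal to \<open>j\<close> is \<^const>\<open>count\<close> and
  \<open>\<eta>\<close> is \<^const>\<open>sum_mset\<close>.
\<close>

type_synonym 'd spart = "int ^ 'd \<Rightarrow> nat multiset"

definition spatial_partitions :: "nat \<Rightarrow> ('d::finite) spart set" where
  "spatial_partitions n =
     {lam. (\<forall>x. 0 \<notin># lam x) \<and> finite {x. lam x \<noteq> {#}} \<and>
           (\<Sum>x | lam x \<noteq> {#}. sum_mset (lam x)) = n}"

definition exp_neg :: "ereal \<Rightarrow> real" where
  "exp_neg v = (if v = \<infinity> then 0 else exp (- real_of_ereal v))"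

definition rescale :: "real \<Rightarrow> int ^ 'd \<Rightarrow> real ^ ('d::finite)" where
  "rescale L x = (\<chi> i. real_of_int (x $ i) / L)"

text \<open>All factors with \<open>j \<notin># lam x\<close> equal 1, so the products range over the support only.\<close>

definition weight :: "real \<Rightarrow> real \<Rightarrow> (real ^ 'd \<Rightarrow> ereal) \<Rightarrow> ('d::finite) spart \<Rightarrow> real" where
  "weight \<theta> L V lam =
     (\<Prod>x | lam x \<noteq> {#}. \<Prod>j\<in>set_mset (lam x).
        1 / fact (count (lam x) j) *
        (\<theta> / real j * exp_neg (ereal (real j) * V (rescale L x))) ^ count (lam x) j)"

definition partition_function ::
    "real \<Rightarrow> real \<Rightarrow> (real ^ 'd \<Rightarrow> ereal) \<Rightarrow> nat \<Rightarrow> ('d::finite) itself \<Rightarrow> real" where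
  "partition_function \<theta> L V n _ =
     (\<Sum>\<^sub>\<infinity>lam\<in>(spatial_partitions n :: 'd spart set). weight \<theta> L V lam)"

definition gibbs ::
    "real \<Rightarrow> real \<Rightarrow> (real ^ 'd \<Rightarrow> ereal) \<Rightarrow> nat \<Rightarrow> ('d::finite) spart \<Rightarrow> real" where
  "gibbs \<theta> L V n lam = weight \<theta> L V lam / partition_function \<theta> L V n TYPE('d)"

definition exit_rate :: "real \<Rightarrow> nat \<Rightarrow> real" where
  "exit_rate \<theta> m = (if m = 0 then 0 else real m / (\<theta> + real m - 1))"

definition p_minus :: "nat \<Rightarrow> nat multiset \<Rightarrow> real" where
  "p_minus j m = real (j * count m j) / real (sum_mset m)"

definition p_plus :: "real \<Rightarrow> nat \<Rightarrow> nat multiset \<Rightarrow> real" where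
  "p_plus \<theta> k m =
     (if k = 0 then \<theta> else real (k * count m k)) / (real (sum_mset m) + \<theta>)"

definition leave_table :: "nat \<Rightarrow> nat multiset \<Rightarrow> nat multiset" where
  "leave_table j m = (if j = 1 then m - {#1#} else m - {#j#} + {#j - 1#})"

definition join_table :: "nat \<Rightarrow> nat multiset \<Rightarrow> nat multiset" where
  "join_table k m = (if k = 0 then m + {#1#} else m - {#k#} + {#k + 1#})"

definition depart :: "int ^ 'd \<Rightarrow> nat \<Rightarrow> ('d::finite) spart \<Rightarrow> 'd spart" where
  "depart x j lam = lam(x := leave_table j (lam x))"

definition arrive :: "int ^ 'd \<Rightarrow> nat \<Rightarrow> ('d::finite) spart \<Rightarrow> 'd spart" where
  "arrive y k lam = lam(y := join_table k (lam y))"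

text \<open>
  \<open>(x, j, y, k)\<close>: a customer goes from a table of size \<open>j\<close> at \<open>x\<close> to a table of size \<open>k\<close> at \<open>y\<close>,
  where \<open>k = 0\<close> stands for a new table.
\<close>

definition moves ::
    "('d::finite) spart \<Rightarrow> 'd spart \<Rightarrow> ((int ^ 'd) \<times> nat \<times> (int ^ 'd) \<times> nat) set" where
  "moves lam lam' =
     {(x, j, y, k). j \<in># lam x \<and> (k = 0 \<or> k \<in># depart x j lam y) \<and>
                    lam' = arrive y k (depart x j lam)}"

definition move_rate ::
    "real \<Rightarrow> (int ^ 'd \<Rightarrow> int ^ 'd \<Rightarrow> real) \<Rightarrow> ('d::finite) spart \<Rightarrow>
     (int ^ 'd) \<times> nat \<times> (int ^ 'd) \<times> nat \<Rightarrow> real" where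
  "move_rate \<theta> t lam = (\<lambda>(x, j, y, k).
     exit_rate \<theta> (sum_mset (lam x)) * t x y * p_minus j (lam x) *
     p_plus \<theta> k (depart x j lam y))"

text \<open>For \<open>lam' \<noteq> lam\<close> there is at most one move from \<open>lam\<close> to \<open>lam'\<close>, so the sum has at most one term.\<close>

definition jump_rate ::
    "real \<Rightarrow> (int ^ 'd \<Rightarrow> int ^ 'd \<Rightarrow> real) \<Rightarrow> ('d::finite) spart \<Rightarrow> 'd spart \<Rightarrow> real" where
  "jump_rate \<theta> t lam lam' = (\<Sum>\<^sub>\<infinity>m\<in>moves lam lam'. move_rate \<theta> t lam m)"

definition q_matrix ::
    "real \<Rightarrow> (int ^ 'd \<Rightarrow> int ^ 'd \<Rightarrow> real) \<Rightarrow> nat \<Rightarrow>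
     ('d::finite) spart \<Rightarrow> 'd spart \<Rightarrow> real" where
  "q_matrix \<theta> t n lam lam' =
     (if lam' = lam
      then - (\<Sum>\<^sub>\<infinity>mu\<in>spatial_partitions n - {lam}. jump_rate \<theta> t lam mu)
      else jump_rate \<theta> t lam lam')"

text \<open>Only times \<open>t \<ge> 0\<close> and states in \<open>S\<close> matter below.\<close>

definition markov_semigroup :: "'s set \<Rightarrow> (real \<Rightarrow> 's \<Rightarrow> 's \<Rightarrow> real) \<Rightarrow> bool" where
  "markov_semigroup S P \<longleftrightarrow>
     (\<forall>t\<ge>0. \<forall>a\<in>S. \<forall>b\<in>S. 0 \<le> P t a b) \<and>
     (\<forall>t\<ge>0. \<forall>a\<in>S. (P t a has_sum 1) S) \<and>
     (\<forall>a\<in>S. \<forall>b\<in>S. P 0 a b = (if a = b then 1 else 0)) \<and>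
     (\<forall>s\<ge>0. \<forall>t\<ge>0. \<forall>a\<in>S. \<forall>b\<in>S. ((\<lambda>c. P s a c * P t c b) has_sum P (s + t) a b) S) \<and>
     (\<forall>a\<in>S. \<forall>b\<in>S. ((\<lambda>t. P t a b) \<longlongrightarrow> P 0 a b) (at_right 0))"

text \<open>At \<open>t = 0\<close> the derivative is one-sided.\<close>

definition backward_kolmogorov ::
    "'s set \<Rightarrow> ('s \<Rightarrow> 's \<Rightarrow> real) \<Rightarrow> (real \<Rightarrow> 's \<Rightarrow> 's \<Rightarrow> real) \<Rightarrow> bool" where
  "backward_kolmogorov S q P \<longleftrightarrow>
     (\<forall>t\<ge>0. \<forall>a\<in>S. \<forall>b\<in>S.
        (\<lambda>c. q a c * P t c b) summable_on S \<and>
        ((\<lambda>s. P s a b) has_real_derivative (\<Sum>\<^sub>\<infinity>c\<in>S. q a c * P t c b)) (at t within {0..})) \<and>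
     (\<forall>a\<in>S. \<forall>b\<in>S. P 0 a b = (if a = b then 1 else 0))"

definition past :: "'w measure \<Rightarrow> 's set \<Rightarrow> (real \<Rightarrow> 'w \<Rightarrow> 's) \<Rightarrow> real \<Rightarrow> 'w measure" where
  "past M S X s = sigma (space M) {X u -` {a} \<inter> space M | u a. 0 \<le> u \<and> u \<le> s \<and> a \<in> S}"

definition markov_process ::
    "'w measure \<Rightarrow> 's set \<Rightarrow> (real \<Rightarrow> 's \<Rightarrow> 's \<Rightarrow> real) \<Rightarrow> (real \<Rightarrow> 'w \<Rightarrow> 's) \<Rightarrow> bool" where
  "markov_process M S P X \<longleftrightarrow>
     prob_space M \<and>
     (\<forall>t\<ge>0. X t \<in> measurable M (count_space S)) \<and>
     (\<forall>s\<ge>0. \<forall>t\<ge>s. \<forall>b\<in>S.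
        AE w in M. real_cond_exp M (past M S X s) (indicator {w \<in> space M. X t w = b}) w
                     = P (t - s) (X s w) b)"

definition reversible_measure ::
    "'s set \<Rightarrow> (real \<Rightarrow> 's \<Rightarrow> 's \<Rightarrow> real) \<Rightarrow> ('s \<Rightarrow> real) \<Rightarrow> bool" where
  "reversible_measure S P \<pi> \<longleftrightarrow>
     (\<forall>t\<ge>0. \<forall>a\<in>S. \<forall>b\<in>S. \<pi> a * P t a b = \<pi> b * P t b a)"

definition stationary_measure ::
    "'s set \<Rightarrow> (real \<Rightarrow> 's \<Rightarrow> 's \<Rightarrow> real) \<Rightarrow> ('s \<Rightarrow> real) \<Rightarrow> bool" where
  "stationary_measure S P \<pi> \<longleftrightarrow>
     (\<forall>t\<ge>0. \<forall>b\<in>S. ((\<lambda>a. \<pi> a * P t a b) has_sum \<pi> b) S)"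

end

theory Submission
  imports Defs
begin

text \<open>
  The jump rates are bounded: at most \<open>n\<close> restaurants are occupied, and customers leave each of them
  at total rate at most \<open>max 1 (1 / \<theta>)\<close>. For a rate matrix \<open>q\<close> with exit rates at most
  \<open>K\<close>, uniformization gives the semigroup explicitly. Let \<open>R = I + q / K\<close>, which is a
  stochastic matrix, and let \<open>P t\<close> be the law of the \<open>R\<close>-chain after a Poisson number of steps
  with mean \<open>K t\<close>. The semigroup property is the additivity of independent Poisson variables,
  and termwise differentiation of the Poisson series gives the backward equations. Boundedness also
  yields uniqueness: as an operator on bounded functions \<open>q\<close> has norm at most \<open>2 K\<close>, so two
  solutions agree at times below \<open>1 / (2 K)\<close>, and the semigroup property carries this to all times
  (\<open>backward_kolmogorov_unique\<close>).

  The state space is countable, since a configuration has finite support. The Markov process is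
  obtained from the theorem of Daniell and Kolmogorov, the finite-dimensional laws being consistent
  by the Chapman-Kolmogorov equations. The Markov property holds by construction for events that depend
  on finitely many times, and extends to the whole past by Dynkin's lemma
  (\<open>path_measure_markov_process\<close>).

  Reversibility rests on detailed balance, which holds for each single move
  (\<open>move_rate_balance\<close>). Let a customer go from a table of size \<open>j\<close> at \<open>x\<close> to a table of
  size \<open>k\<close> at \<open>y\<close>, and let \<open>c\<close> be the configuration without this customer. The weights, the
  exit rates and the seating probabilities fit together in such a way that the flow along the move
  equals the weight of \<open>c\<close> times the Boltzmann factor at \<open>x\<close>, times \<open>t x y\<close>, times the
  probabilities that a customer who enters \<open>c\<close> joins a table of size \<open>j - 1\<close> at \<open>x\<close>, and a table of
  size \<open>k\<close> at \<open>y\<close>. The reversed move, from a table of size \<open>k + 1\<close> at \<open>y\<close> to one of size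
  \<open>j - 1\<close> at \<open>x\<close>, passes through the same \<open>c\<close>, and the assumption on \<open>t\<close> makes the two flows
  equal. Detailed balance passes from \<open>q\<close> to the powers of \<open>R\<close> and to \<open>P t\<close>; summing
  it over the initial configuration gives stationarity.
\<close>

section \<open>Expectations as unordered sums\<close>

lemma expectation_has_sum:
  fixes f :: "'a \<Rightarrow> real"
  assumes "set_pmf M \<subseteq> S" and bd: "\<And>x. x \<in> S \<Longrightarrow> \<bar>f x\<bar> \<le> B"
  shows "((\<lambda>x. pmf M x * f x) has_sum measure_pmf.expectation M f) S"
proof -
  define g where "g = (\<lambda>x. if x \<in> S then f x else 0)"
  have eq: "measure_pmf.expectation M f = measure_pmf.expectation M g"
    by (intro integral_cong_AE) (use assms in \<open>auto simp: AE_measure_pmf_iff g_def\<close>)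
  have abs: "Infinite_Set_Sum.abs_summable_on (\<lambda>x. pmf M x * g x) UNIV"
  proof (rule abs_summable_on_comparison_test)
    show "Infinite_Set_Sum.abs_summable_on (\<lambda>x. pmf M x * \<bar>B\<bar>) UNIV"
      by (intro abs_summable_on_cmult_left) auto
    show "norm (pmf M x * g x) \<le> norm (pmf M x * \<bar>B\<bar>)" for x
      using bd[of x] by (auto simp: g_def abs_mult intro!: mult_left_mono)
  qed
  have "(\<lambda>x. pmf M x * g x) summable_on UNIV"
    using abs abs_summable_equivalent by (metis abs_summable_summable)
  then have "((\<lambda>x. pmf M x * g x) has_sum measure_pmf.expectation M g) UNIV"
    by (simp add: pmf_expectation_eq_infsetsum infsetsum_infsum[OF abs] has_sum_infsum)
  then show ?thesis
    unfolding eq by (rule has_sum_cong_neutral[THEN iffD1, rotated -1]) (auto simp: g_def)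
qed

lemma pmf_has_sum_1: "set_pmf M \<subseteq> S \<Longrightarrow> (pmf M has_sum 1) S"
  using expectation_has_sum[of M S "\<lambda>_. 1" 1] by simp

lemma pmf_bind_has_sum:
  "set_pmf M \<subseteq> S \<Longrightarrow> ((\<lambda>c. pmf M c * pmf (f c) b) has_sum pmf (bind_pmf M f) b) S"
  unfolding pmf_bind by (rule expectation_has_sum[where B=1]) (auto simp: pmf_le_1)

lemma embed_pmf_has_sum:
  assumes "\<And>x. x \<in> S \<Longrightarrow> 0 \<le> f x" and "(f has_sum 1) S"
  shows "pmf (embed_pmf (\<lambda>x. if x \<in> S then f x else 0)) x = (if x \<in> S then f x else 0)"
proof (rule pmf_embed_pmf)
  let ?g = "\<lambda>x. if x \<in> S then f x else 0"
  have s: "(?g has_sum 1) UNIV"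
    using assms(2) by (rule has_sum_cong_neutral[THEN iffD1, rotated -1]) auto
  moreover have "(\<lambda>x. norm (?g x)) = ?g"
    using assms(1) by auto
  ultimately have "(\<lambda>x. norm (?g x)) summable_on UNIV"
    by (simp add: has_sum_imp_summable)
  then have abs: "Infinite_Set_Sum.abs_summable_on ?g UNIV"
    by (rule abs_summable_equivalent[THEN iffD1])
  have "infsetsum ?g UNIV = 1"
    unfolding infsetsum_infsum[OF abs] using s by (rule infsumI)
  with nn_integral_conv_infsetsum[OF abs] assms(1)
  show "(\<integral>\<^sup>+x. ennreal (?g x) \<partial>count_space UNIV) = 1" by auto
qed (use assms in auto)

section \<open>Poisson subordination of a discrete chain\<close>

text \<open>
  The number of points of a Poisson process of unit intensity in a time interval of length \<open>r\<close>.
  Interval length \<open>0\<close> is singled out because \<^const>\<open>poisson_pmf\<close> is meaningful for positive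
  rates only; the formula below covers both cases.
\<close>

definition clock :: "real \<Rightarrow> nat pmf" where
  "clock r = (if r > 0 then poisson_pmf r else return_pmf 0)"

lemma pmf_clock: "0 \<le> r \<Longrightarrow> pmf (clock r) k = r ^ k / fact k * exp (- r)"
  by (cases "r = 0") (auto simp: clock_def indicator_def power_0_left)

lemma bind_clock_sums:
  assumes "0 \<le> r"
  shows "(\<lambda>k. exp (- r) * (pmf (f k) b / fact k * r ^ k)) sums pmf (bind_pmf (clock r) f) b"
  using has_sum_imp_sums[OF pmf_bind_has_sum[of "clock r" UNIV f b]] assms
  by (simp add: pmf_clock field_simps)

text \<open>
  Independent Poisson increments add up: expanding \<open>(r + s) ^ k\<close> by the binomial theorem gives the
  convolution.
\<close>

lemma clock_add:
  assumes "0 \<le> r" "0 \<le> s"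
  shows "bind_pmf (clock r) (\<lambda>i. map_pmf ((+) i) (clock s)) = clock (r + s)"
proof (rule pmf_eqI)
  fix k
  have m: "pmf (map_pmf ((+) i) (clock s)) k = (if i \<le> k then pmf (clock s) (k - i) else 0)" for i
  proof (cases "i \<le> k")
    case True
    then show ?thesis
      using pmf_map_inj'[of "(+) i" "clock s" "k - i"] by simp
  qed (subst pmf_map_outside, auto)
  have "pmf (bind_pmf (clock r) (\<lambda>i. map_pmf ((+) i) (clock s))) k =
     (\<Sum>i. exp (- r) * (pmf (map_pmf ((+) i) (clock s)) k / fact i * r ^ i))"
    using bind_clock_sums[OF assms(1)] by (rule sums_unique)
  also have "\<dots> = (\<Sum>i\<le>k. exp (- r) * (pmf (map_pmf ((+) i) (clock s)) k / fact i * r ^ i))"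
    by (rule suminf_finite) (auto simp: m)
  also have "\<dots> = (\<Sum>i\<le>k. exp (- r) * exp (- s) / fact k * (of_nat (k choose i) * r ^ i * s ^ (k - i)))"
    by (intro sum.cong) (auto simp: m pmf_clock assms binomial_fact field_simps)
  also have "\<dots> = pmf (clock (r + s)) k"
    using assms by (simp add: pmf_clock binomial_ring sum_distrib_left sum_distrib_right sum_divide_distrib
        exp_add[symmetric] mult_ac)
  finally show "pmf (bind_pmf (clock r) (\<lambda>i. map_pmf ((+) i) (clock s))) k = pmf (clock (r + s)) k" .
qed

primrec steps :: "('s \<Rightarrow> 's pmf) \<Rightarrow> nat \<Rightarrow> 's \<Rightarrow> 's pmf" where
  "steps R 0 a = return_pmf a"
| "steps R (Suc k) a = bind_pmf (R a) (steps R k)"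

lemma steps_add: "steps R (i + j) a = bind_pmf (steps R i a) (steps R j)"
proof (induction i arbitrary: a)
  case (Suc i)
  have "steps R (Suc i + j) a = bind_pmf (R a) (\<lambda>c. bind_pmf (steps R i c) (steps R j))"
    by (simp flip: Suc.IH)
  then show ?case by (simp add: bind_assoc_pmf)
qed (simp add: bind_return_pmf)

lemma set_steps:
  assumes "\<And>a. a \<in> S \<Longrightarrow> set_pmf (R a) \<subseteq> S" "a \<in> S"
  shows "set_pmf (steps R k a) \<subseteq> S"
  using assms(2)
proof (induction k arbitrary: a)
  case (Suc k)
  then show ?case using assms(1)[OF Suc.prems] by (fastforce simp: set_bind_pmf)
qed simp

text \<open>
  Reversibility is inherited by powers of a kernel, since a first step on the one side turns into a
  last step on the other side.
\<close>

lemma steps_reversible: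
  assumes "\<And>a. a \<in> S \<Longrightarrow> set_pmf (R a) \<subseteq> S"
    and rev: "\<And>a b. a \<in> S \<Longrightarrow> b \<in> S \<Longrightarrow> w a * pmf (R a) b = w b * pmf (R b) a"
    and "a \<in> S" "b \<in> S"
  shows "w a * pmf (steps R k a) b = w b * pmf (steps R k b) a"
  using assms(3,4)
proof (induction k arbitrary: a b)
  case (Suc k)
  have "steps R 0 = return_pmf"
    by (simp add: fun_eq_iff)
  then have "steps R 1 = R"
    by (auto simp: bind_return_pmf' simp del: steps.simps(1))
  then have last: "bind_pmf (steps R k b) R = steps R (Suc k) b"
    using steps_add[of R k 1 b] by simp
  have "w a * (pmf (R a) c * pmf (steps R k c) b) = w b * (pmf (steps R k b) c * pmf (R c) a)"
    if "c \<in> S" for c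
    using rev[OF Suc.prems(1) that] Suc.IH[OF Suc.prems(2) that]
    by (metis mult.assoc mult.commute)
  moreover have "((\<lambda>c. w a * (pmf (R a) c * pmf (steps R k c) b)) has_sum w a * pmf (steps R (Suc k) a) b) S"
    using Suc.prems assms(1) by (auto intro!: has_sum_cmult_right pmf_bind_has_sum)
  ultimately have "((\<lambda>c. w b * (pmf (steps R k b) c * pmf (R c) a)) has_sum w a * pmf (steps R (Suc k) a) b) S"
    by (simp cong: has_sum_cong)
  moreover have "((\<lambda>c. w b * (pmf (steps R k b) c * pmf (R c) a)) has_sum w b * pmf (steps R (Suc k) b) a) S"
    unfolding last[symmetric] using Suc.prems set_steps[of S R] assms(1)
    by (intro has_sum_cmult_right pmf_bind_has_sum) auto
  ultimately show ?case by (rule has_sum_unique)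
qed (auto simp: pmf_return indicator_def)

section \<open>Uniformization of bounded rates\<close>

text \<open>
  A conservative rate matrix whose exit rates are bounded by \<open>K\<close>. Such a chain can be run with a
  Poisson clock of intensity \<open>K\<close>: when the clock rings, the state moves according to the stochastic
  matrix \<open>I + q / K\<close>, the diagonal of which absorbs the surplus of rings.
\<close>

locale bounded_rates =
  fixes S :: "'s set" and q :: "'s \<Rightarrow> 's \<Rightarrow> real" and K :: real
  assumes K_pos: "0 < K"
    and off_diagonal: "\<And>a b. a \<in> S \<Longrightarrow> b \<in> S \<Longrightarrow> a \<noteq> b \<Longrightarrow> 0 \<le> q a b"
    and conservative: "\<And>a. a \<in> S \<Longrightarrow> (q a has_sum 0) S"
    and diagonal: "\<And>a. a \<in> S \<Longrightarrow> - K \<le> q a a"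
begin

definition step :: "'s \<Rightarrow> 's pmf" where
  "step a = embed_pmf (\<lambda>b. if b \<in> S then of_bool (a = b) + q a b / K else 0)"

lemma pmf_step:
  assumes "a \<in> S"
  shows "pmf (step a) b = (if b \<in> S then of_bool (a = b) + q a b / K else 0)"
  unfolding step_def
proof (rule embed_pmf_has_sum)
  show "0 \<le> of_bool (a = b) + q a b / K" if "b \<in> S" for b
    using that assms off_diagonal[of a b] diagonal[of a] K_pos by (auto simp: field_simps)
  have "((\<lambda>b. of_bool (a = b)) has_sum (1::real)) S"
    using assms by (intro has_sum_finite_neutralI[of "{a}"]) auto
  moreover have "((\<lambda>b. q a b / K) has_sum 0 / K) S"
    unfolding divide_inverse by (intro has_sum_cmult_left conservative assms)
  ultimately show "((\<lambda>b. of_bool (a = b) + q a b / K) has_sum 1) S"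
    using has_sum_add by fastforce
qed

lemma set_step: "a \<in> S \<Longrightarrow> set_pmf (step a) \<subseteq> S"
  by (auto simp: set_pmf_iff pmf_step split: if_splits)

lemma rate_eq: "a \<in> S \<Longrightarrow> b \<in> S \<Longrightarrow> q a b = K * (pmf (step a) b - of_bool (a = b))"
  using K_pos by (simp add: pmf_step)

definition transition :: "real \<Rightarrow> 's \<Rightarrow> 's pmf" where
  "transition t a = bind_pmf (clock (K * t)) (\<lambda>k. steps step k a)"

lemma set_transition: "a \<in> S \<Longrightarrow> set_pmf (transition t a) \<subseteq> S"
  using set_steps[where R=step and S=S] set_step by (fastforce simp: transition_def)

lemma transition_0: "transition 0 a = return_pmf a"
  by (simp add: transition_def clock_def bind_return_pmf)

lemma transition_add:
  assumes "0 \<le> s" "0 \<le> t"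
  shows "transition (s + t) a = bind_pmf (transition s a) (transition t)"
proof -
  have "transition (s + t) a = bind_pmf (bind_pmf (clock (K * s)) (\<lambda>i. map_pmf ((+) i) (clock (K * t))))
     (\<lambda>k. steps step k a)"
    using assms K_pos by (simp add: transition_def clock_add distrib_left)
  also have "\<dots> = bind_pmf (clock (K * s)) (\<lambda>i. bind_pmf (clock (K * t)) (\<lambda>j.
      bind_pmf (steps step i a) (steps step j)))"
    by (simp add: bind_assoc_pmf bind_map_pmf steps_add)
  also have "\<dots> = bind_pmf (clock (K * s)) (\<lambda>i. bind_pmf (steps step i a) (transition t))"
    unfolding transition_def by (subst bind_commute_pmf) simp
  finally show ?thesis
    by (simp add: transition_def[of s] bind_assoc_pmf)
qed

lemma generator_has_sum:
  assumes "a \<in> S" "\<And>c. c \<in> S \<Longrightarrow> \<bar>f c\<bar> \<le> B"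
  shows "((\<lambda>c. q a c * f c) has_sum K * (measure_pmf.expectation (step a) f - f a)) S"
proof -
  \<comment> \<open>In terms of the uniformized chain, \<open>q\<close> is \<open>K\<close> times one step minus the identity.\<close>
  have "((\<lambda>c. of_bool (a = c) * f c) has_sum f a) S"
    using assms(1) by (intro has_sum_finite_neutralI[of "{a}"]) auto
  with expectation_has_sum[OF set_step[OF assms(1)], of f B] assms(2)
  have "((\<lambda>c. K * (pmf (step a) c * f c - of_bool (a = c) * f c)) has_sum
      K * (measure_pmf.expectation (step a) f - f a)) S"
    unfolding diff_conv_add_uminus by (intro has_sum_cmult_right has_sum_add) (auto simp: has_sum_uminus)
  then show ?thesis
    by (rule has_sum_cong[THEN iffD1, rotated]) (simp add: rate_eq assms algebra_simps)
qed

text \<open>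
  Conditioning on the number of rings turns the transition probability into \<open>exp (- K t)\<close> times a
  power series in \<open>K t\<close>. Differentiating the series termwise shifts its coefficients by one step of
  the discrete chain, and this step can be pulled to the front.
\<close>

lemma transition_deriv:
  assumes "a \<in> S" "0 \<le> t"
  shows "((\<lambda>t. pmf (transition t a) b) has_real_derivative
    K * (pmf (bind_pmf (step a) (transition t)) b - pmf (transition t a) b)) (at t within {0..})"
proof -
  define c where "c = (\<lambda>k. pmf (steps step k a) b / fact k)"
  have summ: "summable (\<lambda>k. c k * y ^ k)" for y
  proof (rule summable_comparison_test[OF _ summable_norm_exp[of y]], intro exI allI impI)
    show "norm (c k * y ^ k) \<le> norm (y ^ k /\<^sub>R fact k)" for k
      using mult_right_mono[OF pmf_le_1[of "steps step k a" b], of "\<bar>y\<bar> ^ k / fact k"]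
      by (simp add: c_def abs_mult power_abs field_simps)
  qed
  let ?G = "\<lambda>y. \<Sum>k. c k * y ^ k" and ?G' = "\<lambda>y. \<Sum>k. diffs c k * y ^ k"
  have tr: "pmf (transition s a) b = exp (- (K * s)) * ?G (K * s)" if "0 \<le> s" for s
  proof -
    have "(\<lambda>k. exp (- (K * s)) * (c k * (K * s) ^ k)) sums pmf (transition s a) b"
      unfolding transition_def c_def using that K_pos by (intro bind_clock_sums) auto
    then show ?thesis
      using sums_unique2[OF _ sums_mult[OF summable_sums[OF summ]]] by blast
  qed
  have commuted: "bind_pmf (step a) (transition t) = bind_pmf (clock (K * t)) (\<lambda>k. steps step (Suc k) a)"
    unfolding transition_def by (subst bind_commute_pmf) simp
  have diffs: "diffs c k = pmf (steps step (Suc k) a) b / fact k" for k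
    by (simp add: diffs_def c_def fact_Suc del: steps.simps)
  have "(\<lambda>k. exp (- (K * t)) * (diffs c k * (K * t) ^ k)) sums pmf (bind_pmf (step a) (transition t)) b"
    unfolding commuted diffs using assms K_pos by (intro bind_clock_sums) auto
  moreover have "summable (\<lambda>k. diffs c k * (K * t) ^ k)"
    by (rule termdiff_converges_all) (rule summ)
  ultimately have st: "pmf (bind_pmf (step a) (transition t)) b = exp (- (K * t)) * ?G' (K * t)"
    using sums_unique2 sums_mult[OF summable_sums] by blast
  have G: "(?G has_field_derivative ?G' y) (at y)" for y
    by (rule termdiffs_strong_converges_everywhere) (rule summ)
  have "((\<lambda>s. exp (- (K * s)) * ?G (K * s)) has_real_derivative
      K * (exp (- (K * t)) * ?G' (K * t) - exp (- (K * t)) * ?G (K * t))) (at t)"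
  proof (rule DERIV_cong)
    have "((\<lambda>s. exp (- (K * s))) has_real_derivative exp (- (K * t)) * - K) (at t)"
      by (auto intro!: derivative_eq_intros)
    moreover have "((\<lambda>s. ?G (K * s)) has_real_derivative ?G' (K * t) * K) (at t)"
      by (rule DERIV_chain2[OF G]) (auto intro!: derivative_eq_intros)
    ultimately show "((\<lambda>s. exp (- (K * s)) * ?G (K * s)) has_real_derivative
        exp (- (K * t)) * - K * ?G (K * t) + ?G' (K * t) * K * exp (- (K * t))) (at t)"
      by (rule DERIV_mult)
  qed (simp add: right_diff_distrib)
  then have "((\<lambda>s. exp (- (K * s)) * ?G (K * s)) has_real_derivative
      K * (pmf (bind_pmf (step a) (transition t)) b - pmf (transition t a) b)) (at t within {0..})"
    unfolding st tr[OF assms(2)] by (rule has_field_derivative_at_within)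
  then show ?thesis
    by (rule has_field_derivative_transform_within[where d=1]) (use assms tr in auto)
qed

lemma transition_backward_kolmogorov: "backward_kolmogorov S q (\<lambda>t a b. pmf (transition t a) b)"
  unfolding backward_kolmogorov_def
proof (intro conjI allI impI ballI)
  fix t :: real and a b assume t: "0 \<le> t" and a: "a \<in> S" and b: "b \<in> S"
  have s: "((\<lambda>c. q a c * pmf (transition t c) b) has_sum
      K * (pmf (bind_pmf (step a) (transition t)) b - pmf (transition t a) b)) S"
    unfolding pmf_bind by (rule generator_has_sum[where B=1]) (auto simp: a pmf_le_1)
  then show "(\<lambda>c. q a c * pmf (transition t c) b) summable_on S"
    by (rule has_sum_imp_summable)
  show "((\<lambda>s. pmf (transition s a) b) has_real_derivative (\<Sum>\<^sub>\<infinity>c\<in>S. q a c * pmf (transition t c) b))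
      (at t within {0..})"
    unfolding infsumI[OF s] by (rule transition_deriv[OF a t])
next
  show "pmf (transition 0 a) b = (if a = b then 1 else 0)" for a b
    by (simp add: transition_0 pmf_return indicator_def)
qed

lemma transition_markov_semigroup: "markov_semigroup S (\<lambda>t a b. pmf (transition t a) b)"
  unfolding markov_semigroup_def
proof (intro conjI allI impI ballI)
  fix t s :: real and a b assume "0 \<le> t" "0 \<le> s" and a: "a \<in> S" and b: "b \<in> S"
  then show "((\<lambda>c. pmf (transition s a) c * pmf (transition t c) b) has_sum pmf (transition (s + t) a) b) S"
    by (subst transition_add) (auto intro!: pmf_bind_has_sum set_transition)
next
  fix a b assume a: "a \<in> S"
  have "((\<lambda>t. pmf (transition t a) b) \<longlongrightarrow> pmf (transition 0 a) b) (at 0 within {0..})"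
    using DERIV_continuous[OF transition_deriv[OF a, of 0 b]] by (simp add: continuous_within)
  then show "((\<lambda>t. pmf (transition t a) b) \<longlongrightarrow> pmf (transition 0 a) b) (at_right 0)"
    by (rule tendsto_within_subset) auto
qed (auto simp: set_transition pmf_has_sum_1 transition_0 pmf_return indicator_def)

text \<open>
  The difference of two solutions is bounded by \<open>1\<close> and vanishes at time \<open>0\<close>. Since \<open>q\<close>
  has norm at most \<open>2 K\<close> on bounded functions, the mean value theorem improves a bound \<open>c\<close>,
  uniform in the state, on the time interval up to \<open>s\<close> to the bound \<open>2 K s c\<close>. Iterating
  this leaves only \<open>0\<close> if \<open>2 K s < 1\<close>.
\<close>

lemma backward_kolmogorov_short_time:
  assumes M: "markov_semigroup S P" and B: "backward_kolmogorov S q P"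
    and M': "markov_semigroup S P'" and B': "backward_kolmogorov S q P'"
    and "a \<in> S" "b \<in> S" "0 \<le> s" "2 * K * s < 1"
  shows "P' s a b = P s a b"
proof -
  define D where "D = (\<lambda>u c. P' u c b - P u c b)"
  have le1: "0 \<le> Q u c b \<and> Q u c b \<le> 1"
    if "markov_semigroup S Q" "0 \<le> u" "c \<in> S" for Q :: "real \<Rightarrow> 's \<Rightarrow> 's \<Rightarrow> real" and u c
  proof -
    have nn: "\<forall>d\<in>S. 0 \<le> Q u c d" and "(Q u c has_sum 1) S"
      using that by (auto simp: markov_semigroup_def)
    then show ?thesis
      using finite_sum_le_has_sum[where f="Q u c" and B="{b}"] \<open>b \<in> S\<close> by auto
  qed
  have sumD: "((\<lambda>u. D u c) has_real_derivative (\<Sum>\<^sub>\<infinity>d\<in>S. q c d * D u d)) (at u within {0..})"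
    if "0 \<le> u" "c \<in> S" for u c
  proof -
    have "(\<lambda>d. q c d * Q u d b) summable_on S" if "backward_kolmogorov S q Q" for Q
      using that \<open>0 \<le> u\<close> \<open>c \<in> S\<close> \<open>b \<in> S\<close> by (auto simp: backward_kolmogorov_def)
    then have "((\<lambda>d. q c d * P' u d b + - (q c d * P u d b)) has_sum
        (\<Sum>\<^sub>\<infinity>d\<in>S. q c d * P' u d b) + - (\<Sum>\<^sub>\<infinity>d\<in>S. q c d * P u d b)) S"
      using B B' by (intro has_sum_add) (auto simp: has_sum_uminus)
    then have "(\<Sum>\<^sub>\<infinity>d\<in>S. q c d * D u d) = (\<Sum>\<^sub>\<infinity>d\<in>S. q c d * P' u d b) - (\<Sum>\<^sub>\<infinity>d\<in>S. q c d * P u d b)"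
      unfolding D_def right_diff_distrib by (simp add: infsumI)
    then show ?thesis
      using that B B' \<open>b \<in> S\<close> unfolding D_def
      by (auto simp: backward_kolmogorov_def intro!: derivative_intros)
  qed
  \<comment> \<open>One mean value estimate per power of \<open>2 K u\<close>.\<close>
  have bound: "\<bar>D u c\<bar> \<le> (2 * K * u) ^ k" if "0 \<le> u" "c \<in> S" for u c k
    using that
  proof (induction k arbitrary: u c)
    case 0
    then show ?case using le1[OF M, of u c] le1[OF M', of u c] by (auto simp: D_def)
  next
    case (Suc k)
    have "norm (D u c - D 0 c) \<le> (2 * K) * (2 * K * u) ^ k * norm (u - 0)"
    proof (rule field_differentiable_bound[of "{0..u}" "\<lambda>v. D v c"])
      fix v assume v: "v \<in> {0..u}"
      then show "((\<lambda>v. D v c) has_real_derivative (\<Sum>\<^sub>\<infinity>d\<in>S. q c d * D v d)) (at v within {0..u})"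
        using Suc.prems by (intro DERIV_subset[OF sumD]) auto
      have *: "\<bar>D v d\<bar> \<le> (2 * K * u) ^ k" if "d \<in> S" for d
      proof -
        have "\<bar>D v d\<bar> \<le> (2 * K * v) ^ k" using Suc.IH v that by auto
        also have "\<dots> \<le> (2 * K * u) ^ k" using v K_pos by (intro power_mono) auto
        finally show ?thesis .
      qed
      let ?E = "measure_pmf.expectation (step c) (D v)"
      have "\<bar>?E\<bar> \<le> (2 * K * u) ^ k"
      proof -
        have ae: "AE x in measure_pmf (step c). \<bar>D v x\<bar> \<le> (2 * K * u) ^ k"
          using * set_step[OF Suc.prems(2)] by (auto simp: AE_measure_pmf_iff)
        have "\<bar>?E\<bar> \<le> measure_pmf.expectation (step c) (\<lambda>x. \<bar>D v x\<bar>)"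
          by (rule integral_abs_bound)
        also have "\<dots> \<le> measure_pmf.expectation (step c) (\<lambda>x. (2 * K * u) ^ k)"
          using ae by (intro integral_mono_AE) (auto intro!: measure_pmf.integrable_const_bound)
        finally show ?thesis by simp
      qed
      then have "\<bar>?E - D v c\<bar> \<le> 2 * (2 * K * u) ^ k" using *[OF Suc.prems(2)] by linarith
      then have "K * \<bar>?E - D v c\<bar> \<le> K * (2 * (2 * K * u) ^ k)" using K_pos by (intro mult_left_mono) auto
      then show "norm (\<Sum>\<^sub>\<infinity>d\<in>S. q c d * D v d) \<le> (2 * K) * (2 * K * u) ^ k"
        using infsumI[OF generator_has_sum[OF Suc.prems(2) *]] K_pos by (simp add: abs_mult)
    qed (use Suc.prems in auto)
    moreover have "D 0 c = 0"
      using Suc.prems \<open>b \<in> S\<close> B B' by (simp add: D_def backward_kolmogorov_def)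
    ultimately show ?case using Suc.prems by (simp add: mult_ac)
  qed
  have "(\<lambda>k. (2 * K * s) ^ k) \<longlonglongrightarrow> 0"
    using assms K_pos by (intro LIMSEQ_realpow_zero) auto
  then have "\<bar>D s a\<bar> \<le> 0"
    by (rule tendsto_lowerbound) (use bound assms in auto)
  then show ?thesis by (simp add: D_def)
qed

text \<open>
  The semigroup property determines the values at time \<open>s\<close> from those at time \<open>s / 2\<close>, so
  that finitely many halvings reduce any time to a short one.
\<close>

lemma backward_kolmogorov_unique:
  assumes M: "markov_semigroup S P" and B: "backward_kolmogorov S q P"
    and M': "markov_semigroup S P'" and B': "backward_kolmogorov S q P'"
    and "a \<in> S" "b \<in> S" "0 \<le> s"
  shows "P' s a b = P s a b"
proof -
  have "P' s a b = P s a b" if "2 * K * s < 2 ^ m" "0 \<le> s" "a \<in> S" "b \<in> S" for m s a b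
    using that
  proof (induction m arbitrary: s a b)
    case 0
    then show ?case using backward_kolmogorov_short_time[OF M B M' B'] by simp
  next
    case (Suc m)
    have CK: "((\<lambda>c. Q (s/2) a c * Q (s/2) c b) has_sum Q (s/2 + s/2) a b) S"
      if "markov_semigroup S Q" for Q
      using that Suc.prems unfolding markov_semigroup_def by (metis divide_nonneg_pos zero_less_numeral)
    have half: "P' (s/2) c d = P (s/2) c d" if "c \<in> S" "d \<in> S" for c d
      using Suc.IH[of "s/2" c d] Suc.prems that by auto
    have "((\<lambda>c. P (s/2) a c * P (s/2) c b) has_sum P' (s/2 + s/2) a b) S"
      using CK[OF M'] by (rule has_sum_cong[THEN iffD1, rotated]) (use half Suc.prems in auto)
    with CK[OF M] show ?case using has_sum_unique by fastforce
  qed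
  moreover obtain m where "2 * K * s < 2 ^ m"
    using real_arch_pow[of 2 "2 * K * s"] by auto
  ultimately show ?thesis using assms by blast
qed

text \<open>
  Detailed balance for \<open>q\<close> is detailed balance for \<open>I + q / K\<close>, hence for all its powers, hence
  for their Poisson mixtures.
\<close>

lemma transition_reversible:
  assumes bal: "\<And>a b. a \<in> S \<Longrightarrow> b \<in> S \<Longrightarrow> w a * q a b = w b * q b a"
  shows "reversible_measure S (\<lambda>t a b. pmf (transition t a) b) w"
  unfolding reversible_measure_def
proof (intro allI impI ballI)
  fix t :: real and a b assume t: "0 \<le> t" and ab: "a \<in> S" "b \<in> S"
  have "w x * pmf (step x) y = w y * pmf (step y) x" if "x \<in> S" "y \<in> S" for x y
    using bal[OF that] that K_pos by (cases "x = y") (auto simp: pmf_step field_simps)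
  then have "w a * pmf (steps step k a) b = w b * pmf (steps step k b) a" for k
    using steps_reversible[where R=step and S=S and w=w] set_step ab by blast
  moreover have "(\<lambda>k. w x * (exp (- (K * t)) * (pmf (steps step k x) y / fact k * (K * t) ^ k)))
      sums (w x * pmf (transition t x) y)" for x y
    unfolding transition_def using t K_pos by (intro sums_mult bind_clock_sums) auto
  then have "w x * pmf (transition t x) y =
      (\<Sum>k. exp (- (K * t)) * (w x * pmf (steps step k x) y / fact k * (K * t) ^ k))" for x y
    by (simp add: sums_iff mult_ac)
  ultimately show "w a * pmf (transition t a) b = w b * pmf (transition t b) a"
    by simp
qed

end

lemma reversible_imp_stationary:
  assumes "markov_semigroup S P" "reversible_measure S P w"
  shows "stationary_measure S P w"
  unfolding stationary_measure_def
proof (intro allI impI ballI)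
  fix t :: real and b assume t: "0 \<le> t" and b: "b \<in> S"
  then have "((\<lambda>a. w b * P t b a) has_sum w b * 1) S"
    using assms(1) by (intro has_sum_cmult_right) (auto simp: markov_semigroup_def)
  then show "((\<lambda>a. w a * P t a b) has_sum w b) S"
    using assms(2) t b by (subst has_sum_cong[where g="\<lambda>a. w b * P t b a"])
      (auto simp: reversible_measure_def)
qed

section \<open>Finite-dimensional laws of a transition semigroup\<close>

text \<open>
  The joint law of the positions at the times of an increasing list, for a chain that is at \<open>a\<close> at
  time \<open>s\<close>. A position is recorded as a function on all times that is undefined elsewhere, so that
  laws for different lists live on the same type and are compared by restriction.
\<close>

primrec path_law :: "(real \<Rightarrow> 's \<Rightarrow> 's pmf) \<Rightarrow> real \<Rightarrow> 's \<Rightarrow> real list \<Rightarrow> (real \<Rightarrow> 's) pmf" where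
  "path_law p s a [] = return_pmf (\<lambda>_. undefined)"
| "path_law p s a (t # ts) = bind_pmf (p (t - s) a) (\<lambda>b. map_pmf (\<lambda>f. f(t := b)) (path_law p t b ts))"

text \<open>
  The recursion of the definition looks at the first time. The Markov property concerns the last
  time, and requires the recursion from the other end.
\<close>

lemma path_law_snoc:
  assumes "distinct (ts @ [t])"
  shows "path_law p s a (ts @ [t]) =
    bind_pmf (path_law p s a ts) (\<lambda>f. map_pmf (\<lambda>b. f(t := b))
      (p (t - last (s # ts)) (if ts = [] then a else f (last ts))))"
  using assms
proof (induction ts arbitrary: s a)
  case Nil
  show ?case by (simp add: bind_return_pmf map_pmf_def fun_upd_def)
next
  case (Cons u ts)
  have *: "last ts \<noteq> u" if "ts \<noteq> []"
    using Cons.prems that by auto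
  have "map_pmf (\<lambda>f. f(u := b)) (path_law p u b (ts @ [t])) =
    bind_pmf (path_law p u b ts) (\<lambda>f. map_pmf (\<lambda>c. f(u := b, t := c))
      (p (t - last (u # ts)) ((f(u := b)) (last (u # ts)))))" for b
    using Cons.prems *
    by (auto simp: Cons.IH map_bind_pmf map_pmf_comp fun_eq_iff intro!: bind_pmf_cong map_pmf_cong)
  then show ?case
    by (simp add: bind_assoc_pmf bind_map_pmf del: fun_upd_apply)
qed

locale transition_kernels =
  fixes S :: "'s set" and p :: "real \<Rightarrow> 's \<Rightarrow> 's pmf"
  assumes countable_states: "countable S"
    and set_p: "\<And>t a. a \<in> S \<Longrightarrow> set_pmf (p t a) \<subseteq> S"
    and p_0: "\<And>a. p 0 a = return_pmf a"
    and p_add: "\<And>s t a. 0 \<le> s \<Longrightarrow> 0 \<le> t \<Longrightarrow> p (s + t) a = bind_pmf (p s a) (p t)"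
begin

lemma set_path_law: "a \<in> S \<Longrightarrow> set_pmf (path_law p s a ts) \<subseteq> set ts \<rightarrow>\<^sub>E S"
proof (induction ts arbitrary: s a)
  case (Cons t ts)
  show ?case
  proof
    fix g assume "g \<in> set_pmf (path_law p s a (t # ts))"
    then obtain b f where "b \<in> set_pmf (p (t - s) a)" "f \<in> set_pmf (path_law p t b ts)" "g = f(t := b)"
      by auto
    then show "g \<in> set (t # ts) \<rightarrow>\<^sub>E S"
      using set_p[OF Cons.prems] Cons.IH[of b t] by (fastforce simp: PiE_iff extensional_def)
  qed
qed auto

text \<open>
  Chapman-Kolmogorov: a position that is not recorded can be summed out.
\<close>

lemma path_law_start:
  assumes "s \<le> u" "sorted (u # ts)"
  shows "bind_pmf (p (u - s) a) (\<lambda>b. path_law p u b ts) = path_law p s a ts"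
proof (cases ts)
  case (Cons v vs)
  then have "p (v - s) a = bind_pmf (p (u - s) a) (p (v - u))"
    using assms p_add[of "u - s" "v - u" a] by simp
  then show ?thesis by (simp add: Cons bind_assoc_pmf)
qed simp

text \<open>
  Forgetting the position at one time yields the law for the remaining times. The recursion
  only reaches the head of the list, where the claim is the Chapman-Kolmogorov equation.
\<close>

lemma path_law_remove1:
  assumes "a \<in> S" "sorted (s # ts)" "distinct ts" "t \<in> set ts"
  shows "map_pmf (\<lambda>f. f(t := undefined)) (path_law p s a ts) = path_law p s a (remove1 t ts)"
  using assms
proof (induction ts arbitrary: s a)
  case (Cons u ts)
  show ?case
  proof (cases "t = u")
    case True
    have "map_pmf (\<lambda>f. f(u := undefined)) (path_law p u b ts) = path_law p u b ts" if "b \<in> set_pmf (p (u - s) a)" for b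
    proof (rule map_pmf_idI)
      fix f assume "f \<in> set_pmf (path_law p u b ts)"
      then have "f \<in> set ts \<rightarrow>\<^sub>E S"
        using set_path_law[of b u ts] set_p[OF Cons.prems(1)] that by blast
      then show "f(u := undefined) = f" using Cons.prems by (auto simp: PiE_iff extensional_def)
    qed
    then have "map_pmf (\<lambda>f. f(t := undefined)) (path_law p s a (u # ts)) = bind_pmf (p (u - s) a) (\<lambda>b. path_law p u b ts)"
      using True by (auto simp: map_bind_pmf map_pmf_comp intro!: bind_pmf_cong)
    also have "\<dots> = path_law p s a ts"
      using Cons.prems by (intro path_law_start) auto
    finally show ?thesis using True by (simp del: path_law.simps fun_upd_apply)
  next
    case False
    have "map_pmf (\<lambda>f. f(u := b, t := undefined)) (path_law p u b ts) =
      map_pmf (\<lambda>f. f(u := b)) (path_law p u b (remove1 t ts))" if "b \<in> set_pmf (p (u - s) a)" for b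
    proof -
      have "b \<in> S" using set_p[OF Cons.prems(1)] that by blast
      then have "path_law p u b (remove1 t ts) = map_pmf (\<lambda>f. f(t := undefined)) (path_law p u b ts)"
        using Cons False by (auto simp del: fun_upd_apply)
      then show ?thesis using False by (simp add: map_pmf_comp fun_upd_twist)
    qed
    then show ?thesis
      using False by (auto simp: map_bind_pmf map_pmf_comp simp del: fun_upd_apply intro!: bind_pmf_cong)
  qed
qed simp

end

locale markov_chain_law = transition_kernels S p for S :: "'s set" and p +
  fixes \<mu> :: "'s pmf"
  assumes set_initial: "set_pmf \<mu> \<subseteq> S"
begin

definition fdd :: "real set \<Rightarrow> (real \<Rightarrow> 's) pmf" where
  "fdd J = bind_pmf \<mu> (\<lambda>a. path_law p 0 a (sorted_list_of_set J))"

lemma set_fdd: "finite J \<Longrightarrow> set_pmf (fdd J) \<subseteq> J \<rightarrow>\<^sub>E S"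
  using set_path_law[of _ 0 "sorted_list_of_set J"] set_initial by (auto simp: fdd_def simp del: path_law.simps)

lemma fdd_remove:
  assumes "finite J" "J \<subseteq> {0..}" "t \<in> J"
  shows "map_pmf (\<lambda>f. f(t := undefined)) (fdd J) = fdd (J - {t})"
proof -
  have "map_pmf (\<lambda>f. f(t := undefined)) (path_law p 0 a (sorted_list_of_set J)) =
      path_law p 0 a (sorted_list_of_set (J - {t}))" if "a \<in> set_pmf \<mu>" for a
    unfolding sorted_list_of_set_remove[OF assms(1)]
    using assms that set_initial by (intro path_law_remove1) auto
  then show ?thesis
    by (auto simp: fdd_def map_bind_pmf intro!: bind_pmf_cong)
qed

lemma fdd_restrict:
  assumes "finite H" "H \<subseteq> {0..}" "J \<subseteq> H"
  shows "map_pmf (\<lambda>f. restrict f J) (fdd H) = fdd J"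
proof -
  have "map_pmf (\<lambda>f. restrict f J) (fdd (J \<union> D)) = fdd J" if "finite D" "D \<subseteq> H - J" for D
    using that
  proof (induction D)
    case empty
    have "finite J" using assms finite_subset by blast
    then have "restrict f J = f" if "f \<in> set_pmf (fdd J)" for f
      using set_fdd[of J] that by (auto simp: PiE_def intro!: extensional_restrict)
    then show ?case by (simp add: map_pmf_idI del: restrict_apply)
  next
    case (insert t D)
    have "map_pmf (\<lambda>f. restrict f J) (fdd (J \<union> insert t D)) =
        map_pmf (\<lambda>f. restrict f J) (map_pmf (\<lambda>f. f(t := undefined)) (fdd (J \<union> insert t D)))"
      using insert.prems by (auto simp: map_pmf_comp restrict_def fun_eq_iff intro!: map_pmf_cong)
    also have "map_pmf (\<lambda>f. f(t := undefined)) (fdd (J \<union> insert t D)) = fdd (J \<union> insert t D - {t})"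
      using assms insert finite_subset[of J H] by (intro fdd_remove) auto
    also have "J \<union> insert t D - {t} = J \<union> D"
      using insert by auto
    finally show ?case using insert by simp
  qed
  from this[of "H - J"] show ?thesis
    using assms by (simp add: Un_absorb1)
qed

lemma fdd_insert:
  assumes J: "finite J" "s \<in> J" "\<And>u. u \<in> J \<Longrightarrow> u \<le> s" and "s < t"
  shows "fdd (insert t J) = bind_pmf (fdd J) (\<lambda>f. map_pmf (\<lambda>b. f(t := b)) (p (t - s) (f s)))"
proof -
  let ?ts = "sorted_list_of_set J"
  have "t \<notin> J" using assms by fastforce
  have ne: "?ts \<noteq> []" using J by auto
  have "last ?ts = s"
  proof (rule antisym)
    show "last ?ts \<le> s" using J last_in_set[OF ne] by simp
    obtain i where i: "i < length ?ts" "?ts ! i = s"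
      using J by (metis in_set_conv_nth set_sorted_list_of_set)
    then have "?ts ! i \<le> ?ts ! (length ?ts - 1)"
      by (intro sorted_nth_mono) auto
    then show "s \<le> last ?ts" using i ne by (simp add: last_conv_nth)
  qed
  moreover have "sorted_list_of_set (insert t J) = ?ts @ [t]"
  proof -
    have "sorted (?ts @ [t])" "distinct (?ts @ [t])" "set (?ts @ [t]) = insert t J"
      using J \<open>t \<notin> J\<close> \<open>s < t\<close> by (fastforce simp: sorted_append)+
    then show ?thesis by (metis sorted_list_of_set.idem_if_sorted_distinct)
  qed
  ultimately show ?thesis
    using \<open>t \<notin> J\<close> J ne by (simp add: fdd_def path_law_snoc bind_assoc_pmf)
qed

section \<open>The process on path space\<close>

text \<open>
  The extension theorem of Daniell and Kolmogorov concerns processes with values in a Polish space.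
  The countable state space is therefore numbered and embedded into the reals; the process is
  decoded afterwards.
\<close>

definition encode :: "'s \<Rightarrow> real" where
  "encode a = real (to_nat_on S a)"

definition decode :: "real \<Rightarrow> 's" where
  "decode r = from_nat_into S (nat \<lfloor>r\<rfloor>)"

lemma decode_encode: "a \<in> S \<Longrightarrow> decode (encode a) = a"
  by (simp add: decode_def encode_def countable_states)

lemma states_nonempty: "S \<noteq> {}"
  using set_initial set_pmf_not_empty[of \<mu>] by auto

lemma measurable_decode [measurable]: "decode \<in> measurable borel (count_space S)"
proof -
  have "(\<lambda>r::real. nat \<lfloor>r\<rfloor>) \<in> measurable borel (count_space UNIV)"
    by measurable
  moreover have "from_nat_into S \<in> measurable (count_space UNIV) (count_space S)"
    using states_nonempty by (auto intro: from_nat_into)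
  ultimately show ?thesis
    unfolding decode_def by (rule measurable_compose)
qed

lemma measurable_decode_component:
  "u \<in> J \<Longrightarrow> (\<lambda>w. decode (w u)) \<in> measurable (PiM J (\<lambda>_. borel)) (count_space S)"
  by (rule measurable_compose[where f="\<lambda>w. w u" and g=decode and N=borel]) auto

definition coded_fdd :: "real set \<Rightarrow> (real \<Rightarrow> real) measure" where
  "coded_fdd J = distr (fdd J) (PiM J (\<lambda>_. borel)) (\<lambda>f. \<lambda>u\<in>J. encode (f u))"

sublocale coded: polish_projective "{0..}" coded_fdd
proof (intro polish_projective.intro projective_family.intro)
  fix J H :: "real set" assume H: "J \<subseteq> H" "finite H" "H \<subseteq> {0..}"
  let ?e = "\<lambda>J f. \<lambda>u\<in>J. encode (f u)"
  have me: "?e J \<in> measurable (measure_pmf M) (PiM J (\<lambda>_. borel))" for J M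
    by (auto simp: space_PiM)
  have "coded_fdd J = distr (map_pmf (\<lambda>f. restrict f J) (fdd H)) (PiM J (\<lambda>_. borel)) (?e J)"
    using fdd_restrict H by (simp add: coded_fdd_def)
  also have "\<dots> = distr (fdd H) (PiM J (\<lambda>_. borel)) (\<lambda>f. ?e J (restrict f J))"
    unfolding map_pmf_rep_eq by (subst distr_distr) (auto intro: me simp: comp_def measurable_def space_PiM)
  also have "\<dots> = distr (fdd H) (PiM J (\<lambda>_. borel)) (\<lambda>f. restrict (?e H f) J)"
    using H by (intro distr_cong refl) (auto simp: fun_eq_iff)
  also have "\<dots> = distr (coded_fdd H) (PiM J (\<lambda>_. borel)) (\<lambda>f. restrict f J)"
    unfolding coded_fdd_def using H
    by (subst distr_distr) (auto intro!: me measurable_restrict_subset simp: comp_def simp del: measurable_pmf_measure1)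
  finally show "coded_fdd J = distr (coded_fdd H) (PiM J (\<lambda>_. borel)) (\<lambda>f. restrict f J)" .
next
  fix J :: "real set" assume "finite J" "J \<subseteq> {0..}"
  show "prob_space (coded_fdd J)"
    unfolding coded_fdd_def
    by (intro prob_space.prob_space_distr measure_pmf.prob_space_axioms)
      (auto simp: space_PiM)
qed

text \<open>
  The law of the process on the space of its trajectories: the projective limit of the coded
  finite-dimensional laws, with values decoded. Since \<^const>\<open>decode\<close> only takes values in \<open>S\<close>,
  every trajectory, and not only almost every one, stays in \<open>S\<close>.
\<close>

definition path_measure :: "(real \<Rightarrow> 's) measure" where
  "path_measure = distr coded.lim (PiM {0..} (\<lambda>_. count_space S)) (\<lambda>w. \<lambda>u\<in>{0..}. decode (w u))"

lemma measurable_decode_path: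
  "(\<lambda>w. \<lambda>u\<in>{0..}. decode (w u)) \<in> measurable coded.lim (PiM {0..} (\<lambda>_. count_space S))"
  unfolding measurable_cong_sets[OF coded.sets_lim refl]
  by (intro measurable_restrict measurable_decode_component)

lemma space_path_measure: "space path_measure = {0..} \<rightarrow>\<^sub>E S"
  by (simp add: path_measure_def space_PiM)

lemma prob_space_path_measure: "prob_space path_measure"
  unfolding path_measure_def by (intro coded.P.prob_space_distr measurable_decode_path)

lemma measurable_component: "0 \<le> u \<Longrightarrow> (\<lambda>w. w u) \<in> measurable path_measure (count_space S)"
  unfolding path_measure_def measurable_distr_eq1 by (rule measurable_component_singleton) simp

text \<open>
  A process with countably many values, seen at finitely many times, has countably many values as
  well. Therefore every set of finite-dimensional trajectories is an event, and finite-dimensional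
  laws may be handled as discrete distributions.
\<close>

lemma measurable_finite_restrict:
  assumes "finite J" and m: "\<And>u. u \<in> J \<Longrightarrow> (\<lambda>w. g w u) \<in> measurable N (count_space S)"
  shows "(\<lambda>w. \<lambda>u\<in>J. g w u) \<in> measurable N (count_space UNIV)"
proof -
  have c: "countable (J \<rightarrow>\<^sub>E S)" using assms(1) countable_states by (intro countable_PiE) auto
  have gS: "g w u \<in> S" if "w \<in> space N" "u \<in> J" for w u
    using measurable_space[OF m[OF that(2)] that(1)] by simp
  have "(\<lambda>w. \<lambda>u\<in>J. g w u) \<in> measurable N (count_space (J \<rightarrow>\<^sub>E S))"
    unfolding measurable_count_space_eq_countable[OF c]
  proof (intro conjI ballI)
    show "(\<lambda>w. \<lambda>u\<in>J. g w u) \<in> space N \<rightarrow> (J \<rightarrow>\<^sub>E S)"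
      using gS by (intro Pi_I restrict_PiE_iff[THEN iffD2]) blast
  next
    fix h assume h: "h \<in> J \<rightarrow>\<^sub>E S"
    have "(\<lambda>w. \<lambda>u\<in>J. g w u) -` {h} \<inter> space N = {w \<in> space N. \<forall>u\<in>J. g w u = h u}"
      using h by (auto simp: fun_eq_iff PiE_iff extensional_def restrict_def)
    also have "\<dots> \<in> sets N"
    proof (intro sets.sets_Collect_finite_All assms(1))
      fix u assume u: "u \<in> J"
      have "(\<lambda>w. g w u) -` {h u} \<inter> space N \<in> sets N"
        using h u by (intro measurable_sets[OF m]) auto
      then show "{w \<in> space N. g w u = h u} \<in> sets N"
        by (simp add: vimage_def Int_def conj_commute)
    qed
    finally show "(\<lambda>w. \<lambda>u\<in>J. g w u) -` {h} \<inter> space N \<in> sets N" .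
  qed
  then show ?thesis
    by (rule measurable_compose[where f="\<lambda>w. \<lambda>u\<in>J. g w u" and g="\<lambda>f. f"]) simp
qed

text \<open>
  Coding and decoding cancel on the states that occur.
\<close>

lemma path_measure_fdd:
  assumes J: "finite J" "J \<subseteq> {0..}"
  shows "distr path_measure (count_space UNIV) (\<lambda>w. restrict w J) = measure_pmf (fdd J)"
proof -
  let ?d = "\<lambda>J w. \<lambda>u\<in>J. decode (w u)"
  have r: "(\<lambda>w. restrict w J) \<in> measurable (PiM {0..} (\<lambda>_. count_space S)) (count_space UNIV)"
    using J by (intro measurable_finite_restrict measurable_component_singleton) auto
  have dJ: "?d J \<in> measurable (PiM J (\<lambda>_. borel)) (count_space UNIV)"
    using J by (intro measurable_finite_restrict measurable_decode_component) auto
  have lim: "distr coded.lim (PiM J (\<lambda>_. borel)) (\<lambda>w. restrict w J) = coded_fdd J"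
  proof (rule measure_eqI)
    fix A assume "A \<in> sets (distr coded.lim (PiM J (\<lambda>_. borel)) (\<lambda>w. restrict w J))"
    then have A: "A \<in> sets (PiM J (\<lambda>_. borel))" by simp
    have "(\<lambda>w. restrict w J) -` A \<inter> space coded.lim = coded.emb {0..} J A"
      by (auto simp: prod_emb_def space_PiM)
    then show "emeasure (distr coded.lim (PiM J (\<lambda>_. borel)) (\<lambda>w. restrict w J)) A = emeasure (coded_fdd J) A"
      using A J coded.emeasure_lim_emb[of J A]
      by (subst emeasure_distr)
        (auto intro: measurable_restrict_subset simp: measurable_cong_sets[OF coded.sets_lim refl])
  qed (simp add: coded.sets_P J)
  have "distr path_measure (count_space UNIV) (\<lambda>w. restrict w J) =
      distr coded.lim (count_space UNIV) (\<lambda>w. restrict (\<lambda>u\<in>{0..}. decode (w u)) J)"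
    unfolding path_measure_def by (subst distr_distr) (auto intro: r measurable_decode_path simp: comp_def)
  also have "\<dots> = distr coded.lim (count_space UNIV) (\<lambda>w. ?d J (restrict w J))"
    using J by (intro distr_cong refl) (auto simp: fun_eq_iff)
  also have "\<dots> = distr (coded_fdd J) (count_space UNIV) (?d J)"
    unfolding lim[symmetric] using J
    by (subst distr_distr)
      (auto intro: dJ measurable_restrict_subset simp: comp_def measurable_cong_sets[OF coded.sets_lim refl])
  also have "\<dots> = distr (fdd J) (count_space UNIV) (\<lambda>f. ?d J (\<lambda>u\<in>J. encode (f u)))"
    unfolding coded_fdd_def
    by (subst distr_distr) (auto intro!: dJ simp: comp_def space_PiM)
  also have "\<dots> = measure_pmf (map_pmf (\<lambda>f. ?d J (\<lambda>u\<in>J. encode (f u))) (fdd J))"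
    by (simp add: map_pmf_rep_eq)
  also have "map_pmf (\<lambda>f. ?d J (\<lambda>u\<in>J. encode (f u))) (fdd J) = fdd J"
  proof (rule map_pmf_idI)
    fix f assume "f \<in> set_pmf (fdd J)"
    then have "f \<in> J \<rightarrow>\<^sub>E S" using set_fdd J by blast
    then show "?d J (\<lambda>u\<in>J. encode (f u)) = f"
      by (auto simp: fun_eq_iff PiE_iff extensional_def restrict_def decode_encode)
  qed
  finally show ?thesis .
qed

lemma measurable_restrict_path_measure:
  "finite J \<Longrightarrow> J \<subseteq> {0..} \<Longrightarrow> (\<lambda>w. restrict w J) \<in> measurable path_measure (count_space UNIV)"
  using measurable_finite_restrict[of J "\<lambda>w. w" path_measure] measurable_component
  by (meson atLeast_iff subsetD)

lemma integral_path_measure: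
  fixes F :: "(real \<Rightarrow> 's) \<Rightarrow> real"
  assumes "finite J" "J \<subseteq> {0..}"
  shows "(\<integral>w. F (restrict w J) \<partial>path_measure) = measure_pmf.expectation (fdd J) F"
  unfolding path_measure_fdd[OF assms, symmetric]
  by (rule integral_distr[OF measurable_restrict_path_measure[OF assms], symmetric]) simp

text \<open>
  The Markov property for one later time \<open>t\<close> and a past that is observed at finitely many times,
  the last of which is \<open>s\<close>. For \<open>s < t\<close> it is the recursion of the laws at the last time; for
  \<open>s = t\<close> both sides read off the present state, as \<open>p 0\<close> does not move.
\<close>

lemma fdd_markov:
  assumes J: "finite J" "J \<subseteq> {0..}" "s \<in> J" "\<And>u. u \<in> J \<Longrightarrow> u \<le> s" and "s \<le> t"
  shows "measure_pmf.expectation (fdd (insert t J)) (\<lambda>f. indicator C (restrict f J) * indicator {b} (f t)) =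
    measure_pmf.expectation (fdd J) (\<lambda>f. indicator C f * pmf (p (t - s) (f s)) b)"
proof (cases "s = t")
  case True
  then have eq: "insert t J = J" using J by auto
  show ?thesis
    unfolding eq
  proof (intro integral_cong_AE)
    have "f \<in> J \<rightarrow>\<^sub>E S" if "f \<in> set_pmf (fdd J)" for f
      using set_fdd[OF J(1)] that by blast
    then show "AE f in fdd J. indicator C (restrict f J) * indicator {b} (f t) =
        indicator C f * pmf (p (t - s) (f s)) b"
      using True by (auto simp: AE_measure_pmf_iff p_0 PiE_def extensional_restrict
        simp del: restrict_apply split: split_indicator)
  qed auto
next
  case False
  with \<open>s \<le> t\<close> have "s < t" by simp
  then have "t \<notin> J" using J by fastforce
  have ins: "fdd (insert t J) = bind_pmf (fdd J) (\<lambda>f. map_pmf (\<lambda>b. f(t := b)) (p (t - s) (f s)))"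
    using J \<open>s < t\<close> by (intro fdd_insert) auto
  let ?A = "{f. restrict f J \<in> C \<and> f t = b}"
  have "measure_pmf.expectation (fdd (insert t J)) (\<lambda>f. indicator C (restrict f J) * indicator {b} (f t)) =
      (measure_pmf.expectation (fdd (insert t J)) (indicator ?A) :: real)"
    by (intro Bochner_Integration.integral_cong) (auto split: split_indicator)
  also have "\<dots> = measure (fdd (insert t J)) ?A"
    by simp
  also have "\<dots> = pmf (map_pmf (\<lambda>f. f \<in> ?A) (fdd (insert t J))) True"
    by (simp add: pmf_map vimage_def)
  also have "\<dots> = measure_pmf.expectation (fdd J)
      (\<lambda>f. measure (p (t - s) (f s)) {c. f(t := c) \<in> ?A})"
    unfolding ins map_bind_pmf pmf_bind map_pmf_comp
    by (simp add: pmf_map vimage_def del: fun_upd_apply)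
  also have "\<dots> = measure_pmf.expectation (fdd J) (\<lambda>f. indicator C f * pmf (p (t - s) (f s)) b)"
  proof (intro integral_cong_AE)
    have "measure (p (t - s) (f s)) {c. f(t := c) \<in> ?A} = indicator C f * pmf (p (t - s) (f s)) b"
      if "f \<in> set_pmf (fdd J)" for f
    proof -
      have "f \<in> J \<rightarrow>\<^sub>E S"
        using set_fdd[OF J(1)] that by blast
      then have "restrict (f(t := c)) J = f" for c
        using \<open>t \<notin> J\<close> by (auto simp: fun_eq_iff PiE_def extensional_def restrict_def)
      then have "{c. f(t := c) \<in> ?A} = (if f \<in> C then {b} else {})"
        by auto
      then show ?thesis by (auto simp: measure_pmf_single)
    qed
    then show "AE f in fdd J. measure (p (t - s) (f s)) {c. f(t := c) \<in> ?A} =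
        indicator C f * pmf (p (t - s) (f s)) b"
      by (simp add: AE_measure_pmf_iff)
  qed auto
  finally show ?thesis .
qed

lemma path_measure_initial: "a \<in> S \<Longrightarrow> measure path_measure {w \<in> space path_measure. w 0 = a} = pmf \<mu> a"
proof -
  interpret prob_space path_measure by (rule prob_space_path_measure)
  have "measure path_measure {w \<in> space path_measure. w 0 = a} = (\<integral>w. indicator {w \<in> space path_measure. w 0 = a} w \<partial>path_measure)"
    by (simp add: Int_absorb2 subset_eq)
  also have "\<dots> = (\<integral>w. indicator {a} (restrict w {0} 0) \<partial>path_measure)"
    by (intro Bochner_Integration.integral_cong) (auto split: split_indicator)
  also have "\<dots> = measure_pmf.expectation (fdd {0}) (\<lambda>f. indicator {a} (f 0))"
    by (rule integral_path_measure) auto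
  also have "\<dots> = measure_pmf.expectation (fdd {0}) (indicator ((\<lambda>f. f 0) -` {a}))"
    by (intro Bochner_Integration.integral_cong) (auto split: split_indicator)
  also have "\<dots> = pmf (map_pmf (\<lambda>f. f 0) (fdd {0})) a"
    by (simp add: pmf_map)
  also have "map_pmf (\<lambda>f. f 0) (fdd {0}) = \<mu>"
    by (simp add: fdd_def map_bind_pmf map_pmf_comp p_0 bind_return_pmf bind_return_pmf')
  finally show ?thesis .
qed

text \<open>
  The events observed at finitely many times up to \<open>s\<close> form an intersection-stable generator
  of the past. The times are required to include \<open>s\<close> itself, so that the transition
  probability from the present state is a function of the observed positions. Dynkin's lemma
  extends the integral identity from this generator to the whole past; measurability is
  carried along in the induction.
\<close>

lemma path_measure_markov_integral:
  fixes b :: 's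
  assumes "0 \<le> s" "s \<le> t" and A: "A \<in> sets (past path_measure S (\<lambda>u w. w u) s)"
  shows "A \<in> sets path_measure \<and> (LINT w:A|path_measure. indicator {b} (w t)) = (LINT w:A|path_measure. pmf (p (t - s) (w s)) b)"
proof -
  interpret prob_space path_measure by (rule prob_space_path_measure)
  let ?\<Omega> = "space path_measure"
  let ?f = "\<lambda>w. indicator {b} (w t) :: real" and ?g = "\<lambda>w. pmf (p (t - s) (w s)) b"
  define E where "E = {(\<lambda>w. w u) -` {a} \<inter> ?\<Omega> |u a. 0 \<le> u \<and> u \<le> s \<and> a \<in> S}"
  define G where "G = {(\<lambda>w. restrict w J) -` C \<inter> ?\<Omega> |J C. finite J \<and> J \<subseteq> {0..s} \<and> s \<in> J}"
  have GI: "(\<lambda>w. restrict w J) -` C \<inter> ?\<Omega> \<in> G" if "finite J" "J \<subseteq> {0..s}" "s \<in> J" for J C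
    unfolding G_def using that by blast
  have "E \<subseteq> G"
  proof
    fix X assume "X \<in> E"
    then obtain u a where u: "0 \<le> u" "u \<le> s" and X: "X = (\<lambda>w. w u) -` {a} \<inter> ?\<Omega>"
      unfolding E_def by blast
    have "X = (\<lambda>w. restrict w {u, s}) -` {f. f u = a} \<inter> ?\<Omega>"
      unfolding X by auto
    also have "\<dots> \<in> G" using u assms by (intro GI) auto
    finally show "X \<in> G" .
  qed
  have "sets (past path_measure S (\<lambda>u w. w u) s) = sigma_sets ?\<Omega> E"
    unfolding past_def E_def by (rule sets_measure_of) auto
  also have "\<dots> \<subseteq> sigma_sets ?\<Omega> G"
    using \<open>E \<subseteq> G\<close> by (rule sigma_sets_mono')
  finally have AG: "A \<in> sigma_sets ?\<Omega> G"
    using A by blast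
  have "Int_stable G"
  proof (rule Int_stableI)
    fix X Y assume "X \<in> G" "Y \<in> G"
    then obtain J C J' C' where J: "finite J" "J \<subseteq> {0..s}" "s \<in> J" "X = (\<lambda>w. restrict w J) -` C \<inter> ?\<Omega>"
      and J': "finite J'" "J' \<subseteq> {0..s}" "Y = (\<lambda>w. restrict w J') -` C' \<inter> ?\<Omega>"
      unfolding G_def by blast
    have "X \<inter> Y = (\<lambda>w. restrict w (J \<union> J')) -` {f. restrict f J \<in> C \<and> restrict f J' \<in> C'} \<inter> ?\<Omega>"
      unfolding J J' by (auto simp: restrict_restrict Int_absorb1 Int_absorb2)
    also have "\<dots> \<in> G" using J J' by (intro GI) auto
    finally show "X \<inter> Y \<in> G" .
  qed
  have mf: "?f \<in> borel_measurable path_measure" and mg: "?g \<in> borel_measurable path_measure"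
    using assms by (auto intro!: measurable_compose[OF measurable_component])
  have int: "integrable path_measure ?f" "integrable path_measure ?g"
    by (auto intro!: integrable_const_bound[where B=1] mf mg simp: pmf_le_1 split: split_indicator)
  have sint: "set_integrable path_measure X ?f" "set_integrable path_measure X ?g" if "X \<in> sets path_measure" for X
    unfolding set_integrable_def using that int by (auto intro!: integrable_mult_indicator simp del: real_scaleR_def)
  have cyl: "X \<in> sets path_measure \<and> (LINT w:X|path_measure. ?f w) = (LINT w:X|path_measure. ?g w)" if XG: "X \<in> G" for X
  proof -
    obtain J C where J: "finite J" "J \<subseteq> {0..s}" "s \<in> J" and X: "X = (\<lambda>w. restrict w J) -` C \<inter> ?\<Omega>"
      using XG unfolding G_def by blast
    have J0: "J \<subseteq> {0..}" and Jt: "insert t J \<subseteq> {0..}" using J assms by auto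
    have "X \<in> sets path_measure"
      unfolding X by (rule measurable_sets[OF measurable_restrict_path_measure[OF J(1) J0]]) simp
    have "(LINT w:X|path_measure. ?f w) =
        (\<integral>w. indicator C (restrict (restrict w (insert t J)) J) * indicator {b} (restrict w (insert t J) t) \<partial>path_measure)"
    proof -
      have "restrict (restrict w (insert t J)) J = restrict w J" "restrict w (insert t J) t = w t" for w :: "real \<Rightarrow> 's"
        by (auto simp: fun_eq_iff)
      then show ?thesis
        unfolding set_lebesgue_integral_def X
        by (intro Bochner_Integration.integral_cong) (auto simp del: restrict_apply split: split_indicator)
    qed
    also have "\<dots> = measure_pmf.expectation (fdd (insert t J)) (\<lambda>f. indicator C (restrict f J) * indicator {b} (f t))"
      using J(1) Jt
      by (intro integral_path_measure[where F="\<lambda>f. indicator C (restrict f J) * indicator {b} (f t)"]) auto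
    also have "\<dots> = measure_pmf.expectation (fdd J) (\<lambda>f. indicator C f * pmf (p (t - s) (f s)) b)"
      using J J0 assms by (intro fdd_markov) auto
    also have "\<dots> = (\<integral>w. indicator C (restrict w J) * pmf (p (t - s) (restrict w J s)) b \<partial>path_measure)"
      using integral_path_measure[OF J(1) J0, of "\<lambda>f. indicator C f * pmf (p (t - s) (f s)) b"] by simp
    also have "\<dots> = (LINT w:X|path_measure. ?g w)"
      unfolding set_lebesgue_integral_def X using J(3)
      by (intro Bochner_Integration.integral_cong) (auto split: split_indicator)
    finally show ?thesis using \<open>X \<in> sets path_measure\<close> by simp
  qed
  have "G \<subseteq> Pow ?\<Omega>" by (auto simp: G_def)
  with \<open>Int_stable G\<close> show ?thesis
    using AG
  proof (induction rule: sigma_sets_induct_disjoint)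
    case (basic X)
    then show ?case by (rule cyl)
  next
    case empty
    then show ?case by (simp add: set_lebesgue_integral_def)
  next
    case (compl X)
    have "(\<lambda>w. restrict w {s}) -` UNIV \<inter> ?\<Omega> \<in> G" using assms by (intro GI) auto
    then have top: "(LINT w:?\<Omega>|path_measure. ?f w) = (LINT w:?\<Omega>|path_measure. ?g w)" using cyl by auto
    have X: "X \<in> sets path_measure" using compl by auto
    then have "X \<union> (?\<Omega> - X) = ?\<Omega>" using sets.sets_into_space by blast
    then have "(LINT w:?\<Omega>|path_measure. h w) = (LINT w:X|path_measure. h w) + (LINT w:?\<Omega> - X|path_measure. h w)"
      if "set_integrable path_measure X h" "set_integrable path_measure (?\<Omega> - X) h" for h :: "_ \<Rightarrow> real"
      using set_integral_Un[of X "?\<Omega> - X" path_measure h] that by (simp add: Int_Diff)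
    from this[of ?f] this[of ?g] show ?case using X sint top compl by auto
  next
    case (union X)
    have X: "X i \<in> sets path_measure" for i using union by auto
    then have "(\<Union>i. X i) \<in> sets path_measure" by auto
    moreover have "(LINT w:(\<Union>i. X i)|path_measure. h w) = (\<Sum>i. LINT w:X i|path_measure. h w)"
      if "set_integrable path_measure (\<Union>i. X i) h" for h :: "_ \<Rightarrow> real"
      using union(1) that X by (intro lebesgue_integral_countable_add) (auto simp: disjoint_family_on_def)
    ultimately show ?case using sint union by auto
  qed
qed

lemma path_measure_markov_process: "markov_process path_measure S (\<lambda>t a b. pmf (p t a) b) (\<lambda>u w. w u)"
  unfolding markov_process_def
proof (intro conjI allI impI ballI)
  show "prob_space path_measure" by (rule prob_space_path_measure)
next
  fix s t :: real and b assume st: "0 \<le> s" "s \<le> t" and "b \<in> S"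
  interpret prob_space path_measure by (rule prob_space_path_measure)
  let ?F = "past path_measure S (\<lambda>u w. w u) s" and ?g = "\<lambda>w. pmf (p (t - s) (w s)) b"
  have space_F: "space ?F = space path_measure"
    by (auto simp: past_def space_measure_of_conv)
  have sub: "subalgebra path_measure ?F"
    unfolding subalgebra_def using path_measure_markov_integral[OF st] space_F by auto
  interpret F: finite_measure_subalgebra path_measure ?F
    by unfold_locales (rule sub)
  have "(\<lambda>w. w s) \<in> measurable ?F (count_space S)"
    unfolding measurable_count_space_eq_countable[OF countable_states] space_F
  proof (intro conjI ballI)
    show "(\<lambda>w. w s) \<in> space path_measure \<rightarrow> S" using st by (auto simp: space_path_measure)
    show "(\<lambda>w. w s) -` {a} \<inter> space path_measure \<in> sets ?F" if "a \<in> S" for a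
    proof -
      have "(\<lambda>w. w s) -` {a} \<inter> space path_measure \<in>
          {(\<lambda>w. w u) -` {a} \<inter> space path_measure |u a. 0 \<le> u \<and> u \<le> s \<and> a \<in> S}"
        using st that by blast
      then show ?thesis unfolding past_def by (subst sets_measure_of) auto
    qed
  qed
  then have gF: "?g \<in> borel_measurable ?F"
    by (rule measurable_compose) auto
  have g: "?g \<in> borel_measurable path_measure"
    using gF sub by (rule measurable_from_subalg[rotated])
  have f: "{w \<in> space path_measure. w t = b} \<in> sets path_measure"
    using measurable_sets[OF measurable_component[of t], of "{b}"] st \<open>b \<in> S\<close>
    by (simp add: vimage_def Int_def conj_commute)
  show "AE w in path_measure. real_cond_exp path_measure ?F (indicator {w \<in> space path_measure. w t = b}) w = ?g w"
  proof (rule F.real_cond_exp_charact)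
    fix A assume A: "A \<in> sets ?F"
    have "(LINT w:A|path_measure. indicator {w \<in> space path_measure. w t = b} w) = (LINT w:A|path_measure. indicator {b} (w t) :: real)"
      unfolding set_lebesgue_integral_def
      by (intro Bochner_Integration.integral_cong) (auto split: split_indicator)
    then show "(LINT w:A|path_measure. indicator {w \<in> space path_measure. w t = b} w) = (LINT w:A|path_measure. ?g w)"
      using path_measure_markov_integral[OF st A, of b] by simp
  qed (use f g gF in \<open>auto intro!: integrable_const_bound[where B=1] simp: pmf_le_1 less_top[symmetric]\<close>)
qed (rule measurable_component)

end

section \<open>The total jump rate of the restaurants\<close>

text \<open>
  The number of customers is kept as one term rather than expanded into a sum of real numbers.
\<close>

declare of_nat_sum_mset [simp del]

lemma sum_mset_eq_sum_count: "sum_mset m = (\<Sum>j\<in>set_mset m. j * count m j)" for m :: "nat multiset"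
proof (induction m)
  case (add k m)
  have "(\<Sum>j\<in>set_mset (add_mset k m). j * count (add_mset k m) j) =
      (\<Sum>j\<in>insert k (set_mset m). j * count m j + (if j = k then k else 0))"
    by (intro sum.cong) auto
  also have "\<dots> = (\<Sum>j\<in>insert k (set_mset m). j * count m j) + k"
    by (simp add: sum.distrib)
  also have "(\<Sum>j\<in>insert k (set_mset m). j * count m j) = (\<Sum>j\<in>set_mset m. j * count m j)"
    by (intro sum.mono_neutral_right) (auto simp: not_in_iff)
  finally show ?case using add by simp
qed simp

lemma sum_p_plus:
  assumes "0 < \<theta>"
  shows "(\<Sum>k\<in>insert 0 (set_mset m). p_plus \<theta> k m) = 1"
proof -
  have "(\<Sum>k\<in>set_mset m - {0}. p_plus \<theta> k m) = (\<Sum>k\<in>set_mset m - {0}. real (k * count m k)) / (real (sum_mset m) + \<theta>)"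
    by (simp add: p_plus_def sum_divide_distrib)
  also have "(\<Sum>k\<in>set_mset m - {0}. real (k * count m k)) = (\<Sum>k\<in>set_mset m. real (k * count m k))"
    by (intro sum.mono_neutral_left) auto
  also have "\<dots> = real (sum_mset m)"
    by (simp add: sum_mset_eq_sum_count)
  finally show ?thesis
    using assms by (simp add: sum.insert_remove p_plus_def add_divide_distrib[symmetric] add.commute)
qed

lemma sum_p_minus:
  assumes "m \<noteq> {#}" "0 \<notin># m"
  shows "(\<Sum>j\<in>set_mset m. p_minus j m) = 1"
proof -
  have "sum_mset m \<noteq> 0"
    using assms by (metis multiset_nonemptyE sum_mset_0_iff)
  moreover have "(\<Sum>j\<in>set_mset m. p_minus j m) = real (sum_mset m) / real (sum_mset m)"
    unfolding p_minus_def sum_divide_distrib[symmetric] by (simp add: sum_mset_eq_sum_count)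
  ultimately show ?thesis by simp
qed

lemma exit_rate_nonneg: "0 < \<theta> \<Longrightarrow> 0 \<le> exit_rate \<theta> m"
  by (auto simp: exit_rate_def)

text \<open>
  The rate tends to \<open>1\<close>, from above for \<open>\<theta> < 1\<close> with maximum \<open>1 / \<theta>\<close> at one customer,
  from below for \<open>\<theta> > 1\<close>.
\<close>

lemma exit_rate_le:
  assumes "0 < \<theta>"
  shows "exit_rate \<theta> m \<le> max 1 (1 / \<theta>)"
proof (cases "m = 0")
  case False
  then have m: "1 \<le> real m" by simp
  show ?thesis
  proof (cases "1 \<le> \<theta>")
    case True
    then show ?thesis using m by (auto simp: exit_rate_def field_simps)
  next
    case False
    have "0 \<le> (real m - 1) * (1 - \<theta>)" using m False by (intro mult_nonneg_nonneg) auto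
    then have "real m * \<theta> \<le> \<theta> + real m - 1" by (simp add: algebra_simps)
    then have "exit_rate \<theta> m \<le> 1 / \<theta>"
      using m assms by (auto simp: exit_rate_def field_simps)
    then show ?thesis by simp
  qed
qed (auto simp: exit_rate_def)

lemma p_plus_nonneg: "0 < \<theta> \<Longrightarrow> 0 \<le> p_plus \<theta> k m"
  by (auto simp: p_plus_def intro!: divide_nonneg_nonneg add_nonneg_nonneg)

lemma move_rate_nonneg:
  "0 < \<theta> \<Longrightarrow> (\<And>x y. 0 \<le> t x y) \<Longrightarrow> 0 \<le> move_rate \<theta> t lam m"
  by (cases m) (auto simp: move_rate_def p_minus_def intro!: mult_nonneg_nonneg divide_nonneg_nonneg exit_rate_nonneg p_plus_nonneg)

definition all_moves :: "('d::finite) spart \<Rightarrow> ((int ^ 'd) \<times> nat \<times> (int ^ 'd) \<times> nat) set" where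
  "all_moves lam = {(x, j, y, k). j \<in># lam x \<and> (k = 0 \<or> k \<in># depart x j lam y)}"

lemma spatial_partitions_D:
  assumes "lam \<in> spatial_partitions n"
  shows "0 \<notin># lam x" "finite {x. lam x \<noteq> {#}}" "card {x. lam x \<noteq> {#}} \<le> n"
proof -
  show fin: "finite {x. lam x \<noteq> {#}}" and pos: "0 \<notin># lam x" for x
    using assms by (auto simp: spatial_partitions_def)
  have "1 \<le> sum_mset (lam x)" if "lam x \<noteq> {#}" for x
    using pos[of x] that by (metis One_nat_def Suc_leI gr0I multiset_nonemptyE sum_mset_0_iff)
  then have "(\<Sum>x | lam x \<noteq> {#}. 1) \<le> (\<Sum>x | lam x \<noteq> {#}. sum_mset (lam x))"
    by (intro sum_mono) auto
  then show "card {x. lam x \<noteq> {#}} \<le> n"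
    using assms by (simp add: spatial_partitions_def)
qed

lemma sum_Sigma_pair:
  "finite A \<Longrightarrow> (\<And>x. x \<in> A \<Longrightarrow> finite (B x)) \<Longrightarrow> sum f (Sigma A B) = (\<Sum>x\<in>A. \<Sum>y\<in>B x. f (x, y))"
  by (simp add: sum.Sigma)

text \<open>
  The probabilities of the new table, of the new restaurant and of the old table sum to at most
  \<open>1\<close>, one after the other. What remains is the sum of the exit rates over the nonempty
  restaurants, of which there are at most \<open>n\<close>.
\<close>

lemma sum_move_rate_le:
  assumes \<theta>: "0 < \<theta>" and t: "\<And>x y. 0 \<le> t x y" "\<And>x. (t x has_sum 1) UNIV"
    and lam: "lam \<in> spatial_partitions n" and F: "finite F" "F \<subseteq> all_moves lam"
  shows "sum (move_rate \<theta> t lam) F \<le> real n * max 1 (1 / \<theta>)"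
proof -
  let ?X = "{x. lam x \<noteq> {#}}"
  define Y where "Y = (\<lambda>(x, j, y, k). y) ` F"
  have fin: "finite Y" "finite ?X" using F spatial_partitions_D[OF lam] by (auto simp: Y_def)
  let ?K = "\<lambda>x j y. insert 0 (set_mset (depart x j lam y))"
  let ?B = "SIGMA x:?X. SIGMA j:set_mset (lam x). SIGMA y:Y. ?K x j y"
  have "F \<subseteq> ?B"
  proof
    fix z assume z: "z \<in> F"
    then obtain x j y k where "z = (x, j, y, k)" by (cases z) auto
    moreover have "y \<in> Y" using z calculation by (force simp: Y_def)
    ultimately show "z \<in> ?B" using z F by (auto simp: all_moves_def)
  qed
  then have "sum (move_rate \<theta> t lam) F \<le> sum (move_rate \<theta> t lam) ?B"
    using fin by (intro sum_mono2 finite_SigmaI) (auto intro: move_rate_nonneg \<theta> t)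
  also have "\<dots> = (\<Sum>x\<in>?X. \<Sum>j\<in>set_mset (lam x). \<Sum>y\<in>Y. \<Sum>k\<in>?K x j y. move_rate \<theta> t lam (x, j, y, k))"
    using fin by (simp add: sum_Sigma_pair)
  also have "\<dots> = (\<Sum>x\<in>?X. \<Sum>j\<in>set_mset (lam x). \<Sum>y\<in>Y. exit_rate \<theta> (sum_mset (lam x)) * t x y * p_minus j (lam x))"
    by (simp only: move_rate_def prod.case sum_distrib_left[symmetric] sum_p_plus[OF \<theta>] mult_1_right)
  also have "\<dots> = (\<Sum>x\<in>?X. exit_rate \<theta> (sum_mset (lam x)) * sum (t x) Y * (\<Sum>j\<in>set_mset (lam x). p_minus j (lam x)))"
    by (simp only: sum_distrib_left[symmetric] sum_distrib_right[symmetric])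
  also have "\<dots> = (\<Sum>x\<in>?X. exit_rate \<theta> (sum_mset (lam x)) * sum (t x) Y)"
    using spatial_partitions_D[OF lam] by (intro sum.cong) (auto simp: sum_p_minus)
  also have "\<dots> \<le> (\<Sum>x\<in>?X. max 1 (1 / \<theta>) * 1)"
  proof (intro sum_mono mult_mono exit_rate_le \<theta>)
    show "sum (t x) Y \<le> 1" for x
      using finite_sum_le_has_sum[OF t(2) fin(1)] t(1) by auto
  qed (auto intro!: sum_nonneg t)
  also have "\<dots> \<le> real n * max 1 (1 / \<theta>)"
    using spatial_partitions_D(3)[OF lam] by (auto intro!: mult_right_mono)
  finally show ?thesis .
qed

lemma jump_rate_nonneg:
  "0 < \<theta> \<Longrightarrow> (\<And>x y. 0 \<le> t x y) \<Longrightarrow> 0 \<le> jump_rate \<theta> t lam mu"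
  unfolding jump_rate_def by (intro infsum_nonneg move_rate_nonneg) auto

text \<open>
  Every move leads to only one configuration, so the sum of the jump rates over target
  configurations is a sum over moves, grouped by target.
\<close>

lemma jump_rates_bounded:
  assumes \<theta>: "0 < \<theta>" and t: "\<And>x y. 0 \<le> t x y" "\<And>x. (t x has_sum 1) UNIV"
    and lam: "lam \<in> spatial_partitions n"
  shows "jump_rate \<theta> t lam summable_on A"
    and "infsum (jump_rate \<theta> t lam) A \<le> real n * max 1 (1 / \<theta>)"
proof -
  let ?f = "move_rate \<theta> t lam" and ?R = "Sigma A (moves lam)"
  have nn: "0 \<le> ?f m" for m using move_rate_nonneg \<theta> t by blast
  have inj: "inj_on snd ?R" by (auto simp: inj_on_def moves_def)
  have sub: "snd ` ?R \<subseteq> all_moves lam" by (auto simp: moves_def all_moves_def)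
  have le: "sum ?f F \<le> real n * max 1 (1 / \<theta>)" if "finite F" "F \<subseteq> snd ` ?R" for F
    using that sub by (intro sum_move_rate_le \<theta> t lam) auto
  have summ: "?f summable_on snd ` ?R"
    by (rule nonneg_bdd_above_summable_on) (auto intro!: nn bdd_aboveI2[OF le])
  have le': "infsum ?f (snd ` ?R) \<le> real n * max 1 (1 / \<theta>)"
    using summ by (rule infsum_le_finite_sums) (use le in auto)
  have cp: "(\<lambda>(mu, m). ?f m) = ?f \<circ> snd" by auto
  have R: "(\<lambda>(mu, m). ?f m) summable_on ?R"
    "infsum (\<lambda>(mu, m). ?f m) ?R \<le> real n * max 1 (1 / \<theta>)"
    unfolding cp using summ le' summable_on_reindex[OF inj, of ?f] infsum_reindex[OF inj, of ?f] by auto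
  show "jump_rate \<theta> t lam summable_on A"
    using summable_on_Sigma_banach[OF R(1)] by (simp add: jump_rate_def[abs_def])
  show "infsum (jump_rate \<theta> t lam) A \<le> real n * max 1 (1 / \<theta>)"
    using infsum_Sigma'_banach[OF R(1)] R(2) by (simp add: jump_rate_def[abs_def])
qed

text \<open>
  The summand \<open>1\<close> keeps the bound positive when there are no customers.
\<close>

lemma restaurant_bounded_rates:
  assumes \<theta>: "0 < \<theta>" and t: "\<And>x y. 0 \<le> t x y" "\<And>x. (t x has_sum 1) UNIV"
  shows "bounded_rates (spatial_partitions n) (q_matrix \<theta> t n) (1 + real n * max 1 (1 / \<theta>))"
proof
  show "0 < 1 + real n * max 1 (1 / \<theta>)"
    by (intro add_pos_nonneg) auto
next
  fix a b :: "'a spart" assume "a \<noteq> b"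
  then show "0 \<le> q_matrix \<theta> t n a b"
    using jump_rate_nonneg[of \<theta> t] \<theta> t by (auto simp: q_matrix_def)
next
  fix a :: "'a spart" assume a: "a \<in> spatial_partitions n"
  let ?S = "spatial_partitions n :: 'a spart set" and ?q = "q_matrix \<theta> t n a"
  have qa: "(\<Sum>\<^sub>\<infinity>mu\<in>?S - {a}. jump_rate \<theta> t a mu) = - ?q a"
    by (simp add: q_matrix_def)
  have "(jump_rate \<theta> t a has_sum (\<Sum>\<^sub>\<infinity>mu\<in>?S - {a}. jump_rate \<theta> t a mu)) (?S - {a})"
    using jump_rates_bounded(1)[OF \<theta> t a] by simp
  moreover have "(?q has_sum s) (?S - {a}) \<longleftrightarrow> (jump_rate \<theta> t a has_sum s) (?S - {a})" for s
    by (rule has_sum_cong) (auto simp: q_matrix_def)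
  ultimately have "(?q has_sum - ?q a) (?S - {a})"
    by (simp only: qa)
  moreover have "(?q has_sum ?q a) {a}" by (rule has_sum_finiteI) auto
  ultimately have "(?q has_sum ?q a + - ?q a) ({a} \<union> (?S - {a}))"
    by (intro has_sum_Un_disjoint) auto
  then show "(?q has_sum 0) ?S" using a by (simp add: insert_absorb)
  show "- (1 + real n * max 1 (1 / \<theta>)) \<le> ?q a"
    using jump_rates_bounded(2)[where A="?S - {a}" and t=t, OF \<theta> t a] by (simp add: q_matrix_def)
qed

lemma countable_spatial_partitions: "countable (spatial_partitions n :: ('d::finite) spart set)"
proof (rule countable_image_inj_on)
  \<comment> \<open>A configuration is determined by the finite part of its graph over the nonempty sites.\<close>
  let ?g = "\<lambda>lam :: 'd spart. (\<lambda>x. (x, lam x)) ` {x. lam x \<noteq> {#}}"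
  have "(UNIV :: nat multiset set) = range mset" using ex_mset by (metis surjI)
  then have "countable (UNIV :: nat multiset set)" by (metis countable_image uncountable_def countableI_type)
  then have "countable ((UNIV :: (int ^ 'd) set) \<times> (UNIV :: nat multiset set))"
    by (intro countable_SIGMA) auto
  from countable_Collect_finite_subset[OF this] show "countable (?g ` spatial_partitions n)"
    by (rule countable_subset[rotated]) (auto simp: spatial_partitions_def)
  show "inj_on ?g (spatial_partitions n)"
  proof (rule inj_onI)
    fix a b :: "'d spart" assume eq: "?g a = ?g b"
    have *: "a x = m \<longleftrightarrow> (x, m) \<in> ?g a" "b x = m \<longleftrightarrow> (x, m) \<in> ?g b" if "m \<noteq> {#}" for x m
      using that by auto
    show "a = b"
    proof
      fix x show "a x = b x" using *[of "a x" x] *[of "b x" x] eq by metis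
    qed
  qed
qed

section \<open>Detailed balance\<close>

text \<open>
  The factor of the weight that belongs to one site, where \<open>e\<close> is the Boltzmann factor of a
  single customer there.
\<close>

definition site_weight :: "real \<Rightarrow> real \<Rightarrow> nat multiset \<Rightarrow> real" where
  "site_weight \<theta> e m = (\<Prod>j\<in>set_mset m. 1 / fact (count m j) * (\<theta> / real j * e ^ j) ^ count m j)"

lemma exp_neg_mult: "v \<noteq> -\<infinity> \<Longrightarrow> exp_neg (ereal (real j) * v) = exp_neg v ^ j"
  by (cases v; cases "j = 0") (auto simp: exp_neg_def exp_of_nat_mult[symmetric])

lemma weight_eq_prod_site_weight:
  assumes "\<And>u. V u \<noteq> -\<infinity>" "finite X" "{x. lam x \<noteq> {#}} \<subseteq> X"
  shows "weight \<theta> L V lam = (\<Prod>x\<in>X. site_weight \<theta> (exp_neg (V (rescale L x))) (lam x))"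
proof -
  have "weight \<theta> L V lam = (\<Prod>x | lam x \<noteq> {#}. site_weight \<theta> (exp_neg (V (rescale L x))) (lam x))"
    by (simp add: weight_def site_weight_def exp_neg_mult assms)
  also have "\<dots> = (\<Prod>x\<in>X. site_weight \<theta> (exp_neg (V (rescale L x))) (lam x))"
    using assms by (intro prod.mono_neutral_left) (auto simp: site_weight_def)
  finally show ?thesis .
qed

lemma site_weight_add_mset:
  "site_weight \<theta> e (add_mset j m) * (real (count m j) + 1) = site_weight \<theta> e m * (\<theta> / real j * e ^ j)"
proof -
  let ?f = "\<lambda>m i. 1 / fact (count m i) * (\<theta> / real i * e ^ i) ^ count m i"
  have f: "site_weight \<theta> e m' = ?f m' j * (\<Prod>i\<in>set_mset m - {j}. ?f m' i)"
    if "set_mset m' \<subseteq> insert j (set_mset m)" for m'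
  proof -
    have "site_weight \<theta> e m' = prod (?f m') (insert j (set_mset m))"
      unfolding site_weight_def using that by (intro prod.mono_neutral_left) (auto simp: not_in_iff)
    then show ?thesis by (simp add: prod.insert_remove)
  qed
  define rest where "rest = (\<Prod>i\<in>set_mset m - {j}. ?f m i)"
  have "(\<Prod>i\<in>set_mset m - {j}. ?f (add_mset j m) i) = rest"
    unfolding rest_def by (intro prod.cong) auto
  then have add: "site_weight \<theta> e (add_mset j m) = ?f (add_mset j m) j * rest"
    using f[of "add_mset j m"] by simp
  have new: "?f (add_mset j m) j * (real (count m j) + 1) = ?f m j * (\<theta> / real j * e ^ j)"
    by (simp add: divide_simps)
  have "site_weight \<theta> e (add_mset j m) * (real (count m j) + 1) =
      ?f (add_mset j m) j * (real (count m j) + 1) * rest"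
    unfolding add by (simp only: mult_ac)
  also have "\<dots> = ?f m j * rest * (\<theta> / real j * e ^ j)"
    unfolding new by (simp only: mult_ac)
  also have "?f m j * rest = site_weight \<theta> e m"
    using f[OF subset_insertI] by (simp only: rest_def)
  finally show ?thesis .
qed

text \<open>
  There are \<open>j * count m j\<close> customers who can leave a table of size \<open>j\<close>. After the departure, a
  customer joins a table of size \<open>j - 1\<close> in proportion to the number of customers at such tables,
  or, if \<open>j = 1\<close>, opens a new one in proportion to \<open>\<theta>\<close>. The weight turns the one multiplicity
  into the other, at the price of the Boltzmann factor \<open>e\<close> of the customer who left. The
  identity is stated without division by \<open>e\<close> so that it covers sites of infinite potential.
\<close>

lemma site_weight_leave_table:
  assumes "j \<in># m" "0 \<notin># m"
  shows "site_weight \<theta> e m * real (j * count m j) = e * site_weight \<theta> e (leave_table j m) *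
    (if j - 1 = 0 then \<theta> else real ((j - 1) * count (leave_table j m) (j - 1)))"
proof -
  define m0 where "m0 = m - {#j#}"
  have m: "m = add_mset j m0" using assms by (simp add: m0_def)
  have j: "j \<noteq> 0" using assms by metis
  have "site_weight \<theta> e m * real (j * count m j) = real j * (site_weight \<theta> e m0 * (\<theta> / real j * e ^ j))"
    unfolding m site_weight_add_mset[symmetric] by (simp add: algebra_simps)
  also have "\<dots> = \<theta> * e ^ j * site_weight \<theta> e m0" using j by simp
  finally have lhs: "site_weight \<theta> e m * real (j * count m j) = \<theta> * e ^ j * site_weight \<theta> e m0" .
  show ?thesis
  proof (cases "j = 1")
    case True
    then show ?thesis unfolding lhs by (simp add: leave_table_def m0_def)
  next
    case False
    then obtain i where i: "j = Suc i" "i \<noteq> 0" using j by (cases j) auto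
    have "e * site_weight \<theta> e (add_mset i m0) * real (i * count (add_mset i m0) i) =
        e * real i * (site_weight \<theta> e m0 * (\<theta> / real i * e ^ i))"
      unfolding site_weight_add_mset[symmetric] by (simp add: algebra_simps)
    also have "\<dots> = \<theta> * e ^ j * site_weight \<theta> e m0" using i by simp
    finally show ?thesis
      unfolding lhs using i by (auto simp: leave_table_def m0_def)
  qed
qed

lemma sum_mset_leave_table:
  assumes "j \<in># m" "0 \<notin># m"
  shows "sum_mset m = Suc (sum_mset (leave_table j m))"
proof -
  obtain m0 where "m = add_mset j m0" using assms by (meson multi_member_split)
  moreover have "j \<noteq> 0" using assms by metis
  ultimately show ?thesis by (auto simp: leave_table_def)
qed

lemma join_leave_table: "j \<in># m \<Longrightarrow> 0 \<notin># m \<Longrightarrow> join_table (j - 1) (leave_table j m) = m"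
  by (cases "j = 0") (auto simp: join_table_def leave_table_def dest!: multi_member_split)

lemma leave_join_table: "k = 0 \<or> k \<in># m \<Longrightarrow> leave_table (k + 1) (join_table k m) = m"
  by (auto simp: join_table_def leave_table_def)

text \<open>
  The exit rate \<open>m / (\<theta> + m - 1)\<close> is made for this identity: multiplied with the uniform choice of
  a customer among \<open>m\<close>, it leaves the denominator \<open>\<theta> + m - 1\<close>, which is that of the return
  probability when \<open>m - 1\<close> customers are present.
\<close>

lemma weight_depart:
  assumes V: "\<And>u. V u \<noteq> -\<infinity>" and a: "a \<in> spatial_partitions n" and j: "j \<in># a x"
  shows "weight \<theta> L V a * (exit_rate \<theta> (sum_mset (a x)) * p_minus j (a x)) =
    exp_neg (V (rescale L x)) * weight \<theta> L V (depart x j a) * p_plus \<theta> (j - 1) (depart x j a x)"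
proof -
  let ?X = "insert x {x. a x \<noteq> {#}}" and ?e = "exp_neg (V (rescale L x))"
  let ?s = "\<lambda>b y. site_weight \<theta> (exp_neg (V (rescale L y))) (b y)"
  let ?rest = "\<Prod>y\<in>?X - {x}. ?s a y"
  have pos: "0 \<notin># a x" and fin: "finite ?X" using spatial_partitions_D[OF a] by auto
  have wa: "weight \<theta> L V a = ?s a x * ?rest"
    using V fin by (subst weight_eq_prod_site_weight[of V ?X]) (auto simp: prod.insert_remove)
  have "weight \<theta> L V (depart x j a) = (\<Prod>y\<in>?X. ?s (depart x j a) y)"
    using V fin by (intro weight_eq_prod_site_weight) (auto simp: depart_def)
  also have "\<dots> = ?s (depart x j a) x * (\<Prod>y\<in>?X - {x}. ?s (depart x j a) y)"
    using fin by (intro prod.remove) auto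
  also have "(\<Prod>y\<in>?X - {x}. ?s (depart x j a) y) = ?rest"
    by (intro prod.cong) (auto simp: depart_def)
  also have "?s (depart x j a) x = site_weight \<theta> ?e (leave_table j (a x))"
    by (simp add: depart_def)
  finally have wd: "weight \<theta> L V (depart x j a) = site_weight \<theta> ?e (leave_table j (a x)) * ?rest" .
  define D where "D = real (sum_mset (leave_table j (a x))) + \<theta>"
  have sm: "sum_mset (a x) = Suc (sum_mset (leave_table j (a x)))"
    using sum_mset_leave_table[OF j pos] .
  have "exit_rate \<theta> (sum_mset (a x)) * p_minus j (a x) = real (j * count (a x) j) / D"
    unfolding exit_rate_def p_minus_def D_def sm by (simp add: add.commute)
  then have "weight \<theta> L V a * (exit_rate \<theta> (sum_mset (a x)) * p_minus j (a x)) =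
      (?s a x * real (j * count (a x) j)) * ?rest / D"
    by (simp add: wa)
  also have "\<dots> = ?e * weight \<theta> L V (depart x j a) * p_plus \<theta> (j - 1) (leave_table j (a x))"
    unfolding site_weight_leave_table[OF j pos] wd p_plus_def D_def by simp
  finally show ?thesis by (simp add: depart_def)
qed

text \<open>
  Both the move and its reversal pass through the configuration \<open>c\<close> without the travelling customer.
  In terms of \<open>c\<close>, the flow along the move is the weight of \<open>c\<close> times the probabilities of
  joining the table at \<open>y\<close> and of joining the table at \<open>x\<close>, times the Boltzmann factor at \<open>x\<close>
  and \<open>t x y\<close>. The last product is symmetric by assumption.
\<close>

lemma move_rate_balance:
  fixes V :: "real ^ 'd::finite \<Rightarrow> ereal" and a b :: "'d spart"
  assumes V: "\<And>u. V u \<noteq> -\<infinity>" and a: "a \<in> spatial_partitions n" and b: "b \<in> spatial_partitions n"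
    and t: "\<And>x y. exp_neg (V (rescale L x)) * t x y = exp_neg (V (rescale L y)) * t y x"
    and m: "(x, j, y, k) \<in> moves a b"
  shows "(y, k + 1, x, j - 1) \<in> moves b a"
    and "weight \<theta> L V a * move_rate \<theta> t a (x, j, y, k) = weight \<theta> L V b * move_rate \<theta> t b (y, k + 1, x, j - 1)"
proof -
  let ?e = "\<lambda>x. exp_neg (V (rescale L x))"
  define c where "c = depart x j a"
  have j: "j \<in># a x" and k: "k = 0 \<or> k \<in># c y" and bc: "b = arrive y k c"
    using m by (auto simp: moves_def c_def)
  have pos: "0 \<notin># a x" using spatial_partitions_D[OF a] by simp
  have k1: "k + 1 \<in># b y" by (auto simp: bc arrive_def join_table_def)
  have cb: "depart y (k + 1) b = c"
    using leave_join_table[OF k] by (simp add: bc arrive_def depart_def)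
  have "j - 1 = 0 \<or> j - 1 \<in># c x" by (auto simp: c_def depart_def leave_table_def)
  moreover have "a = arrive x (j - 1) c"
    using join_leave_table[OF j pos] by (simp add: c_def arrive_def depart_def)
  ultimately show "(y, k + 1, x, j - 1) \<in> moves b a"
    using k1 cb by (simp add: moves_def)
  have "weight \<theta> L V a * move_rate \<theta> t a (x, j, y, k) =
      (weight \<theta> L V a * (exit_rate \<theta> (sum_mset (a x)) * p_minus j (a x))) * t x y * p_plus \<theta> k (c y)"
    by (simp add: move_rate_def c_def)
  also have "\<dots> = (?e x * t x y) * weight \<theta> L V c * p_plus \<theta> (j - 1) (c x) * p_plus \<theta> k (c y)"
    unfolding weight_depart[where V=V, OF V a j] by (simp add: c_def)
  also have "\<dots> = (?e y * weight \<theta> L V c * p_plus \<theta> k (c y)) * t y x * p_plus \<theta> (j - 1) (c x)"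
    unfolding t[of x y] by simp
  also have "?e y * weight \<theta> L V c * p_plus \<theta> k (c y) =
      weight \<theta> L V b * (exit_rate \<theta> (sum_mset (b y)) * p_minus (k + 1) (b y))"
    using weight_depart[where V=V and L=L and \<theta>=\<theta>, OF V b k1] unfolding cb by simp
  also have "\<dots> * t y x * p_plus \<theta> (j - 1) (c x) = weight \<theta> L V b * move_rate \<theta> t b (y, k + 1, x, j - 1)"
    using cb by (simp add: move_rate_def)
  finally show "weight \<theta> L V a * move_rate \<theta> t a (x, j, y, k) =
      weight \<theta> L V b * move_rate \<theta> t b (y, k + 1, x, j - 1)" .
qed

text \<open>
  Reversal is a bijection between the moves from \<open>a\<close> to \<open>b\<close> and those from \<open>b\<close> to \<open>a\<close>.
  It is an involution since tables are never of size \<open>0\<close>.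
\<close>

lemma jump_rate_balance:
  fixes V :: "real ^ 'd::finite \<Rightarrow> ereal" and a b :: "'d spart"
  assumes V: "\<And>u. V u \<noteq> -\<infinity>" and a: "a \<in> spatial_partitions n" and b: "b \<in> spatial_partitions n"
    and t: "\<And>x y. exp_neg (V (rescale L x)) * t x y = exp_neg (V (rescale L y)) * t y x"
  shows "weight \<theta> L V a * jump_rate \<theta> t a b = weight \<theta> L V b * jump_rate \<theta> t b a"
proof -
  define reverse :: "(int ^ 'd) \<times> nat \<times> (int ^ 'd) \<times> nat \<Rightarrow> _"
    where "reverse = (\<lambda>(x, j, y, k). (y, k + 1, x, j - 1))"
  have inv: "reverse (reverse m) = m" if "m \<in> moves c d" "c \<in> spatial_partitions n" for m and c d :: "'d spart"
  proof -
    obtain x j y k where m: "m = (x, j, y, k)" by (cases m) auto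
    have "j \<noteq> 0" using that spatial_partitions_D(1)[of c n x] unfolding m moves_def by (auto intro!: Nat.gr0I)
    then show ?thesis by (simp add: reverse_def m)
  qed
  have "(\<Sum>\<^sub>\<infinity>m\<in>moves a b. weight \<theta> L V a * move_rate \<theta> t a m) =
      (\<Sum>\<^sub>\<infinity>m\<in>moves b a. weight \<theta> L V b * move_rate \<theta> t b m)"
  proof (rule infsum_reindex_bij_witness[where i=reverse and j=reverse])
    show "reverse (reverse m) = m" if "m \<in> moves a b" for m using inv[OF that a] .
    show "reverse (reverse m) = m" if "m \<in> moves b a" for m using inv[OF that b] .
    show "reverse m \<in> moves b a" if "m \<in> moves a b" for m
      using move_rate_balance(1)[where V=V and L=L and t=t, OF V a b t] that by (cases m) (auto simp: reverse_def)
    show "reverse m \<in> moves a b" if "m \<in> moves b a" for m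
      using move_rate_balance(1)[where V=V and L=L and t=t, OF V b a t] that by (cases m) (auto simp: reverse_def)
    show "weight \<theta> L V b * move_rate \<theta> t b (reverse m) = weight \<theta> L V a * move_rate \<theta> t a m"
      if "m \<in> moves a b" for m
      using move_rate_balance(2)[where V=V and L=L and t=t, OF V a b t] that by (cases m) (auto simp: reverse_def)
  qed
  then show ?thesis
    by (simp add: jump_rate_def infsum_cmult_right')
qed

section \<open>The semigroup and the process of the restaurants\<close>

theorem proposition4p3:
  fixes V :: "real ^ 'd::finite \<Rightarrow> ereal"
    and L \<theta> :: real
    and n :: nat
    and t :: "int ^ 'd \<Rightarrow> int ^ 'd \<Rightarrow> real"
  assumes "L > 0"
    and "\<theta> > 0"
    and "\<And>u. V u \<noteq> -\<infinity>"
    and "weight \<theta> L V summable_on (spatial_partitions n :: 'd spart set)"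
    and "partition_function \<theta> L V n TYPE('d) \<noteq> 0"
    and "\<And>x y. t x y \<ge> 0"
    and "\<And>x. (t x has_sum 1) UNIV"
    and "\<And>x y. exp_neg (V (rescale L x)) * t x y = exp_neg (V (rescale L y)) * t y x"
  defines "S \<equiv> (spatial_partitions n :: 'd spart set)"
    and "q \<equiv> q_matrix \<theta> t n"
  shows "\<exists>P. markov_semigroup S P \<and> backward_kolmogorov S q P \<and>
    (\<forall>P'. markov_semigroup S P' \<and> backward_kolmogorov S q P' \<longrightarrow>
          (\<forall>s\<ge>0. \<forall>a\<in>S. \<forall>b\<in>S. P' s a b = P s a b)) \<and>
    (\<forall>\<mu> :: 'd spart pmf. set_pmf \<mu> \<subseteq> S \<longrightarrow>
       (\<exists>(M :: (real \<Rightarrow> 'd spart) measure) X.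
          markov_process M S P X \<and>
          (\<forall>a\<in>S. measure M {w \<in> space M. X 0 w = a} = pmf \<mu> a))) \<and>
    reversible_measure S P (gibbs \<theta> L V n) \<and>
    stationary_measure S P (gibbs \<theta> L V n)"
proof -
  note \<theta> = assms(2) and V = assms(3) and t = assms(6,7) and detailed = assms(8)
  interpret bounded_rates S q "1 + real n * max 1 (1 / \<theta>)"
    unfolding S_def q_def by (rule restaurant_bounded_rates[where t=t, OF \<theta> t])
  interpret transition_kernels S transition
  proof
    show "countable S" by (simp add: S_def countable_spatial_partitions)
  qed (simp_all add: set_transition transition_0 transition_add)
  let ?P = "\<lambda>t a b. pmf (transition t a) b"
  have "\<exists>(M :: (real \<Rightarrow> 'd spart) measure) X. markov_process M S ?P X \<and>
      (\<forall>a\<in>S. measure M {w \<in> space M. X 0 w = a} = pmf \<mu> a)"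
    if "set_pmf \<mu> \<subseteq> S" for \<mu> :: "'d spart pmf"
  proof -
    interpret markov_chain_law S transition \<mu> by unfold_locales (rule that)
    show ?thesis using path_measure_markov_process path_measure_initial by blast
  qed
  moreover have rev: "reversible_measure S ?P (gibbs \<theta> L V n)"
  proof (rule transition_reversible)
    fix a b assume ab: "a \<in> S" "b \<in> S"
    have "weight \<theta> L V a * q a b = weight \<theta> L V b * q b a"
      using jump_rate_balance[where V=V and L=L and t=t, OF V _ _ detailed, of a n b] ab
      by (cases "a = b") (auto simp: q_def q_matrix_def S_def)
    then show "gibbs \<theta> L V n a * q a b = gibbs \<theta> L V n b * q b a"
      by (simp add: gibbs_def)
  qed
  moreover have "stationary_measure S ?P (gibbs \<theta> L V n)"
    using transition_markov_semigroup rev by (rule reversible_imp_stationary)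
  ultimately show ?thesis
    using transition_markov_semigroup transition_backward_kolmogorov backward_kolmogorov_unique
    by (intro exI[of _ ?P]) blast
qed

end
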